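(* Let $f$ be a continuous map from $\mathrm{Gms}(M)$ to a metric space $T$, and suppose that $f$ is constant on double cosets of $\mathrm{Gms}(M)$ by $\mathrm{Ams}(M)$ (i.e. $f(ugv)=f(g)$ for all $g\in\mathrm{Gms}(M)$ and $u,v\in\mathrm{Ams}(M)$). Then $f$ has the form $f=q\circ\Phi$, where $q:\mathcal{M}\to T$ is a continuous map.
   Context: $\mathbb{R}^\times$ is the set of positive reals, with coordinate $t$. $(M,\mu)$ is a Lebesgue space with a continuous (non-atomic) probability measure. $\mathrm{Gms}(M)$ is the group of all invertible measurable transformations $g$ of $M$ (identified if equal a.e.) leaving $\mu$ quasi-invariant (images and preimages of null sets are null); $\mathrm{Ams}(M)$ is its subgroup of measure-preserving transformations. $g'$ denotes the Radon--Nikodym derivative, $\mu(gA)=\int_A g'\,d\mu$. For measurable $A,B\subset M$, $\kappa[g;A,B]$ is the measure on $\mathbb{R}^\times$ given by $\kappa[g;A,B](E)=\mu\{x\in A\cap g^{-1}(B): g'(x)\in E\}$; $t\kappa$ denotes the measure with density $t$ with respect to $\kappa$. Topology on $\mathrm{Gms}(M)$: the coarsest topology such that for all measurable $A,B$ the maps $g\mapsto\kappa[g;A,B]$ and $g\mapsto t\kappa[g;A,B]$ are continuous for weak convergence of finite measures on $\mathbb{R}^\times$ (so $g_j\to g$ iff both sequences of measures converge weakly for all $A,B$). $\mathcal{M}$ is the space of all measures $\nu$ on $\mathbb{R}^\times$ with $\int_{\mathbb{R}^\times}d\nu(t)=1$ and $\int_{\mathbb{R}^\times}t\,d\nu(t)=1$,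 with the topology in which $\nu^j\to\nu$ iff $\nu^j\to\nu$ and $t\nu^j\to t\nu$ weakly. $\Phi:\mathrm{Gms}(M)\to\mathcal{M}$ assigns to $g$ the distribution of its Radon--Nikodym derivative, $\Phi(g)=\kappa[g;M,M]$. *)

theory Defs
  imports "HOL-Probability.Probability" "HOL-Algebra.Group"
begin

definition iso_mod0 :: "'a measure \<Rightarrow> 'b measure \<Rightarrow> bool" where
  "iso_mod0 M N \<longleftrightarrow>
    (\<exists>X\<in>sets M. \<exists>Y\<in>sets N. \<exists>\<phi>.
        space M - X \<in> null_sets M \<and> space N - Y \<in> null_sets N \<and>
        bij_betw \<phi> X Y \<and>
        \<phi> \<in> restrict_space M X \<rightarrow>\<^sub>M restrict_space N Y \<and>
        the_inv_into X \<phi> \<in> restrict_space N Y \<rightarrow>\<^sub>M restrict_space M X \<and>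
        distr (restrict_space M X) (restrict_space N Y) \<phi> = restrict_space N Y)"

text \<open>Rokhlin's notion: a complete finite measure space that consists, up to a null set, of
  countably many points of positive measure (the set \<open>D\<close>) and a part isomorphic mod 0 to an
  interval with Lebesgue measure.\<close>

definition lebesgue_space :: "'a measure \<Rightarrow> bool" where
  "lebesgue_space M \<longleftrightarrow> finite_measure M \<and> complete_measure M \<and>
    (\<exists>D. D \<subseteq> space M \<and> countable D \<and>
        (\<forall>x\<in>D. {x} \<in> sets M \<and> measure M {x} > 0) \<and>
        iso_mod0 (restrict_space M (space M - D)) (lebesgue_on {0..measure M (space M - D)}))"

definition nonatomic :: "'a measure \<Rightarrow> bool" where
  "nonatomic M \<longleftrightarrow>
    (\<forall>A\<in>sets M. measure M A > 0 \<longrightarrow>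
        (\<exists>B\<in>sets M. B \<subseteq> A \<and> 0 < measure M B \<and> measure M B < measure M A))"

definition transformations :: "'a measure \<Rightarrow> ('a \<Rightarrow> 'a) set" where
  "transformations M = {g. bij_betw g (space M) (space M) \<and>
      g \<in> M \<rightarrow>\<^sub>M M \<and> the_inv_into (space M) g \<in> M \<rightarrow>\<^sub>M M \<and>
      (\<forall>N\<in>null_sets M. g ` N \<in> null_sets M \<and> g -` N \<inter> space M \<in> null_sets M)}"

definition ae_eq :: "'a measure \<Rightarrow> (('a \<Rightarrow> 'a) \<times> ('a \<Rightarrow> 'a)) set" where
  "ae_eq M = {(g, h). g \<in> transformations M \<and> h \<in> transformations M \<and> (AE x in M. g x = h x)}"

text \<open>Elements of the groups are classes of transformations modulo a.e. equality, multiplied by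
  composing representatives. The values of a transformation outside \<^term>\<open>space M\<close> play no role.\<close>

definition Gms :: "'a measure \<Rightarrow> ('a \<Rightarrow> 'a) set monoid" where
  "Gms M = \<lparr>carrier = transformations M // ae_eq M,
     mult = (\<lambda>G H. {k \<in> transformations M. \<exists>g\<in>G. \<exists>h\<in>H. AE x in M. k x = g (h x)}),
     one = {k \<in> transformations M. AE x in M. k x = x}\<rparr>"

definition Ams :: "'a measure \<Rightarrow> ('a \<Rightarrow> 'a) set set" where
  "Ams M = {u \<in> transformations M. distr M M u = M} // ae_eq M"

text \<open>The measure \<open>A \<mapsto> \<mu>(gA)\<close> is the image of \<open>\<mu>\<close> under the inverse of \<open>g\<close>. Its density is
  a.e. positive and finite; the conversion to a real number matters only on a null set.\<close>

definition RN :: "'a measure \<Rightarrow> ('a \<Rightarrow> 'a) \<Rightarrow> 'a \<Rightarrow> real" where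
  "RN M g x = enn2real (RN_deriv M (distr M M (the_inv_into (space M) g)) x)"

definition pos_borel :: "real measure" where
  "pos_borel = restrict_space borel {0<..}"

definition tmult :: "real measure \<Rightarrow> real measure" where
  "tmult \<nu> = density \<nu> (\<lambda>t. ennreal t)"

definition kappa_rep :: "'a measure \<Rightarrow> ('a \<Rightarrow> 'a) \<Rightarrow> 'a set \<Rightarrow> 'a set \<Rightarrow> real measure" where
  "kappa_rep M g A B = measure_of (space pos_borel) (sets pos_borel)
     (\<lambda>E. emeasure M {x \<in> space M. x \<in> A \<and> g x \<in> B \<and> RN M g x \<in> E})"

text \<open>The common value of \<^const>\<open>kappa_rep\<close> on the representatives of a class; see
  \<open>kappa_class\<close> below for well-definedness.\<close>

definition kappa :: "'a measure \<Rightarrow> ('a \<Rightarrow> 'a) set \<Rightarrow> 'a set \<Rightarrow> 'a set \<Rightarrow> real measure" where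
  "kappa M G A B = the_elem ((\<lambda>g. kappa_rep M g A B) ` G)"

definition Phi :: "'a measure \<Rightarrow> ('a \<Rightarrow> 'a) set \<Rightarrow> real measure" where
  "Phi M G = kappa M G (space M) (space M)"

text \<open>The coarsest topology on \<open>S\<close> making all maps in \<open>F\<close> continuous into \<open>Y\<close>.\<close>

definition initial_topology :: "'a set \<Rightarrow> ('a \<Rightarrow> 'b) set \<Rightarrow> 'b topology \<Rightarrow> 'a topology" where
  "initial_topology S F Y =
     topology_generated_by (insert S {S \<inter> h -` U | h U. h \<in> F \<and> openin Y U})"

definition finite_pos_measures :: "real measure set" where
  "finite_pos_measures = {\<nu>. sets \<nu> = sets pos_borel \<and> finite_measure \<nu>}"

definition weak_topology :: "real measure topology" where
  "weak_topology = initial_topology finite_pos_measures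
     {\<lambda>\<nu>. \<integral>t. \<phi> t \<partial>\<nu> | \<phi> :: real \<Rightarrow> real.
        continuous_on {0<..} \<phi> \<and> bounded (\<phi> ` {0<..})}
     euclidean"

definition MM :: "real measure set" where
  "MM = {\<nu>. sets \<nu> = sets pos_borel \<and>
     (\<integral>\<^sup>+t. 1 \<partial>\<nu>) = 1 \<and> (\<integral>\<^sup>+t. ennreal t \<partial>\<nu>) = 1}"

definition MM_topology :: "real measure topology" where
  "MM_topology = initial_topology MM {\<lambda>\<nu>. \<nu>, tmult} weak_topology"

definition Gms_topology :: "'a measure \<Rightarrow> ('a \<Rightarrow> 'a) set topology" where
  "Gms_topology M = initial_topology (carrier (Gms M))
     ({\<lambda>G. kappa M G A B | A B. A \<in> sets M \<and> B \<in> sets M} \<union>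
      {\<lambda>G. tmult (kappa M G A B) | A B. A \<in> sets M \<and> B \<in> sets M})
     weak_topology"

lemma topspace_initial_topology [simp]: "topspace (initial_topology S F Y) = S"
  by (auto simp: initial_topology_def)

lemma transformationsD:
  assumes "g \<in> transformations M"
  shows "bij_betw g (space M) (space M)" "g \<in> M \<rightarrow>\<^sub>M M"
    "the_inv_into (space M) g \<in> M \<rightarrow>\<^sub>M M"
    "N \<in> null_sets M \<Longrightarrow> g ` N \<in> null_sets M"
    "N \<in> null_sets M \<Longrightarrow> g -` N \<inter> space M \<in> null_sets M"
  using assms by (auto simp: transformations_def)

lemma the_inv_into_vimage:
  assumes "bij_betw g S S" "A \<subseteq> S"
  shows "the_inv_into S g -` A \<inter> S = g ` A"
proof (intro Set.set_eqI iffI)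
  fix y assume "y \<in> the_inv_into S g -` A \<inter> S"
  then show "y \<in> g ` A"
    using f_the_inv_into_f_bij_betw[OF assms(1), of y] by (metis IntE imageI vimageE)
next
  fix y assume "y \<in> g ` A"
  then obtain x where "x \<in> A" "y = g x" by blast
  then show "y \<in> the_inv_into S g -` A \<inter> S"
    using assms the_inv_into_f_f[of g S x] by (auto simp: bij_betw_def)
qed

lemma emeasure_distr_inv:
  assumes g: "g \<in> transformations M" and A: "A \<in> sets M"
  shows "g ` A \<in> sets M" "emeasure (distr M M (the_inv_into (space M) g)) A = emeasure M (g ` A)"
proof -
  have e: "the_inv_into (space M) g -` A \<inter> space M = g ` A"
    using the_inv_into_vimage transformationsD(1)[OF g] sets.sets_into_space[OF A] by blast
  show "g ` A \<in> sets M"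
    using measurable_sets[OF transformationsD(3)[OF g] A] e by simp
  show "emeasure (distr M M (the_inv_into (space M) g)) A = emeasure M (g ` A)"
    using e by (simp add: emeasure_distr[OF transformationsD(3)[OF g] A])
qed

lemma distr_inv_cong:
  assumes g: "g \<in> transformations M" and h: "h \<in> transformations M"
    and ae: "AE x in M. g x = h x"
  shows "distr M M (the_inv_into (space M) g) = distr M M (the_inv_into (space M) h)"
proof (rule measure_eqI)
  fix A assume "A \<in> sets (distr M M (the_inv_into (space M) g))"
  then have A: "A \<in> sets M" by simp
  obtain N where N: "{x \<in> space M. g x \<noteq> h x} \<subseteq> N" "N \<in> null_sets M"
    using ae by (auto elim!: AE_E intro: null_setsI)
  have *: "emeasure M (a ` A) \<le> emeasure M (b ` A)"
    if a: "a \<in> transformations M" and b: "b \<in> transformations M"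
      and N': "{x \<in> space M. a x \<noteq> b x} \<subseteq> N" for a b
  proof -
    have "a ` A \<subseteq> b ` A \<union> a ` N"
      using N' sets.sets_into_space[OF A] by force
    then have "emeasure M (a ` A) \<le> emeasure M (b ` A \<union> a ` N)"
      using emeasure_distr_inv(1)[OF b A] transformationsD(4)[OF a N(2)]
      by (intro emeasure_mono) auto
    also have "\<dots> = emeasure M (b ` A)"
      using emeasure_distr_inv(1)[OF b A] transformationsD(4)[OF a N(2)]
      by (rule emeasure_Un_null_set)
    finally show ?thesis .
  qed
  have "{x \<in> space M. h x \<noteq> g x} \<subseteq> N" using N(1) by auto
  then show "emeasure (distr M M (the_inv_into (space M) g)) A =
      emeasure (distr M M (the_inv_into (space M) h)) A"
    using *[OF g h N(1)] *[OF h g] by (simp add: emeasure_distr_inv(2) g h A)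
qed simp

lemma kappa_rep_cong:
  assumes g: "g \<in> transformations M" and h: "h \<in> transformations M"
    and ae: "AE x in M. g x = h x" and A: "A \<in> sets M" and B: "B \<in> sets M"
  shows "kappa_rep M g A B = kappa_rep M h A B"
proof -
  have RN_eq: "RN M g = RN M h"
    by (rule ext) (simp add: RN_def distr_inv_cong[OF g h ae])
  have rn: "RN M h \<in> borel_measurable M"
    unfolding RN_def by measurable
  have "emeasure M {x \<in> space M. x \<in> A \<and> g x \<in> B \<and> RN M g x \<in> E} =
      emeasure M {x \<in> space M. x \<in> A \<and> h x \<in> B \<and> RN M h x \<in> E}"
    if "E \<in> sets pos_borel" for E
  proof (rule emeasure_eq_AE)
    have E: "E \<in> sets borel"
      using that by (auto simp: pos_borel_def sets_restrict_space)
    note [measurable] = transformationsD(2)[OF g] transformationsD(2)[OF h] rn A B E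
    show "AE x in M. x \<in> {x \<in> space M. x \<in> A \<and> g x \<in> B \<and> RN M g x \<in> E} \<longleftrightarrow>
        x \<in> {x \<in> space M. x \<in> A \<and> h x \<in> B \<and> RN M h x \<in> E}"
      using ae by eventually_elim (auto simp: RN_eq)
    show "{x \<in> space M. x \<in> A \<and> g x \<in> B \<and> RN M g x \<in> E} \<in> sets M"
      unfolding RN_eq by measurable
    show "{x \<in> space M. x \<in> A \<and> h x \<in> B \<and> RN M h x \<in> E} \<in> sets M"
      by measurable
  qed
  then show ?thesis
    unfolding kappa_rep_def
    by (intro measure_of_eq) (auto simp: sets.space_closed sets.sigma_sets_eq)
qed

lemma kappa_class:
  assumes "G \<in> carrier (Gms M)" "g \<in> G" "A \<in> sets M" "B \<in> sets M"
  shows "kappa M G A B = kappa_rep M g A B"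
proof -
  have "kappa_rep M h A B = kappa_rep M g A B" if "h \<in> G" for h
  proof -
    obtain k where k: "G = ae_eq M `` {k}"
      using assms(1) by (auto simp: Gms_def elim: quotientE)
    have "AE x in M. k x = g x" "AE x in M. k x = h x"
      using k assms(2) that by (auto simp: ae_eq_def)
    then have "AE x in M. h x = g x" by eventually_elim simp
    then show ?thesis
      using k assms that by (intro kappa_rep_cong) (auto simp: ae_eq_def)
  qed
  then have "(\<lambda>g. kappa_rep M g A B) ` G = {kappa_rep M g A B}"
    using assms(2) by blast
  then show ?thesis by (simp add: kappa_def)
qed

lemma the_inv_into_transformations:
  assumes g: "g \<in> transformations M"
  shows "the_inv_into (space M) g \<in> transformations M"
proof -
  let ?h = "the_inv_into (space M) g"
  have b: "bij_betw g (space M) (space M)" by (rule transformationsD(1)[OF g])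
  have i: "the_inv_into (space M) ?h x = g x" if "x \<in> space M" for x
    using b bij_betw_the_inv_into[OF b] that
    by (metis bij_betw_apply bij_betw_def the_inv_into_f_eq the_inv_into_f_f)
  have im: "?h ` N = g -` N \<inter> space M" if "N \<subseteq> space M" for N
  proof (intro Set.set_eqI iffI)
    fix x assume "x \<in> ?h ` N"
    then obtain y where y: "y \<in> N" "x = ?h y" by blast
    then have "y \<in> space M" using that by blast
    then have "g x = y" "x \<in> space M"
      using y f_the_inv_into_f_bij_betw[OF b, of y] bij_betw_apply[OF bij_betw_the_inv_into[OF b]] by auto
    then show "x \<in> g -` N \<inter> space M" using y by simp
  next
    fix x assume "x \<in> g -` N \<inter> space M"
    then show "x \<in> ?h ` N"
      using the_inv_into_f_f[of g "space M" x] b by (force simp: bij_betw_def image_iff)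
  qed
  have "?h ` N \<in> null_sets M \<and> ?h -` N \<inter> space M \<in> null_sets M" if N: "N \<in> null_sets M" for N
  proof -
    have s: "N \<subseteq> space M" using N by (meson null_setsD2 sets.sets_into_space)
    show ?thesis
      using im[OF s] the_inv_into_vimage[OF b s] transformationsD(4,5)[OF g N] by simp
  qed
  moreover have "the_inv_into (space M) ?h \<in> M \<rightarrow>\<^sub>M M"
    using transformationsD(2)[OF g] i by (subst measurable_cong[OF i]) auto
  ultimately show ?thesis
    using bij_betw_the_inv_into[OF b] transformationsD(3)[OF g] by (auto simp: transformations_def)
qed

lemma comp_transformations:
  assumes g: "g \<in> transformations M" and h: "h \<in> transformations M"
  shows "(\<lambda>x. g (h x)) \<in> transformations M"
proof -
  note bg = transformationsD(1)[OF g] and bh = transformationsD(1)[OF h]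
  have b: "bij_betw (\<lambda>x. g (h x)) (space M) (space M)"
    using bij_betw_trans[OF bh bg] by (simp add: comp_def)
  have i: "the_inv_into (space M) (\<lambda>x. g (h x)) y =
      the_inv_into (space M) h (the_inv_into (space M) g y)" if "y \<in> space M" for y
  proof (rule the_inv_into_f_eq)
    show "inj_on (\<lambda>x. g (h x)) (space M)" using b by (simp add: bij_betw_def)
    have 1: "the_inv_into (space M) g y \<in> space M"
      using bij_betw_apply[OF bij_betw_the_inv_into[OF bg] that] .
    show "the_inv_into (space M) h (the_inv_into (space M) g y) \<in> space M"
      using bij_betw_apply[OF bij_betw_the_inv_into[OF bh] 1] .
    show "g (h (the_inv_into (space M) h (the_inv_into (space M) g y))) = y"
      using f_the_inv_into_f_bij_betw[OF bh 1] f_the_inv_into_f_bij_betw[OF bg that] by simp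
  qed
  have "(\<lambda>x. g (h x)) ` N \<in> null_sets M \<and> (\<lambda>x. g (h x)) -` N \<inter> space M \<in> null_sets M"
    if N: "N \<in> null_sets M" for N
  proof
    show "(\<lambda>x. g (h x)) ` N \<in> null_sets M"
      using transformationsD(4)[OF g transformationsD(4)[OF h N]] by (simp add: image_image)
    have "(\<lambda>x. g (h x)) -` N \<inter> space M = h -` (g -` N \<inter> space M) \<inter> space M"
      using bh by (auto simp: bij_betw_def)
    then show "(\<lambda>x. g (h x)) -` N \<inter> space M \<in> null_sets M"
      using transformationsD(5)[OF h transformationsD(5)[OF g N]] by simp
  qed
  moreover have "(\<lambda>x. g (h x)) \<in> M \<rightarrow>\<^sub>M M"
    using measurable_compose[OF transformationsD(2)[OF h] transformationsD(2)[OF g]] .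
  moreover have "the_inv_into (space M) (\<lambda>x. g (h x)) \<in> M \<rightarrow>\<^sub>M M"
    using measurable_compose[OF transformationsD(3)[OF g] transformationsD(3)[OF h]]
    by (subst measurable_cong[OF i]) auto
  ultimately show ?thesis using b by (auto simp: transformations_def)
qed

lemma AE_transformation:
  assumes h: "h \<in> transformations M" and P: "AE x in M. P x"
  shows "AE x in M. P (h x)"
proof -
  obtain N where N: "{x \<in> space M. \<not> P x} \<subseteq> N" "N \<in> null_sets M"
    using P by (auto elim!: AE_E intro: null_setsI)
  have "{x \<in> space M. \<not> P (h x)} \<subseteq> h -` N \<inter> space M"
    using N(1) transformationsD(1)[OF h] by (auto simp: bij_betw_def)
  then show ?thesis by (rule AE_I'[OF transformationsD(5)[OF h N(2)]])
qed

lemma id_transformations: "(\<lambda>x. x) \<in> transformations M"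
proof -
  have i: "the_inv_into (space M) (\<lambda>x. x) y = y" if "y \<in> space M" for y
    using that by (intro the_inv_into_f_eq) auto
  have "the_inv_into (space M) (\<lambda>x. x) \<in> M \<rightarrow>\<^sub>M M"
    by (subst measurable_cong[OF i]) auto
  moreover have "N \<inter> space M = N" if "N \<in> null_sets M" for N
    using sets.sets_into_space[OF null_setsD2[OF that]] by blast
  ultimately show ?thesis by (auto simp: transformations_def bij_betw_def)
qed

abbreviation "cls M g \<equiv> {k \<in> transformations M. AE x in M. k x = g x}"

lemma Image_ae_eq: "g \<in> transformations M \<Longrightarrow> ae_eq M `` {g} = cls M g"
proof -
  have "(AE x in M. g x = k x) = (AE x in M. k x = g x)" for k
    by (simp only: eq_commute)
  then show "g \<in> transformations M \<Longrightarrow> ae_eq M `` {g} = cls M g" by (auto simp: ae_eq_def)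
qed

lemma carrier_Gms: "carrier (Gms M) = cls M ` transformations M"
proof -
  have "carrier (Gms M) = (\<lambda>g. ae_eq M `` {g}) ` transformations M"
    unfolding Gms_def quotient_def by (simp add: UNION_singleton_eq_range)
  also have "\<dots> = cls M ` transformations M"
    by (rule image_cong[OF refl Image_ae_eq])
  finally show ?thesis .
qed

lemma cls_in: "g \<in> transformations M \<Longrightarrow> cls M g \<in> carrier (Gms M)"
  unfolding carrier_Gms by (rule imageI)

lemma mult_Gms:
  assumes g: "g \<in> transformations M" and h: "h \<in> transformations M"
  shows "cls M g \<otimes>\<^bsub>Gms M\<^esub> cls M h = cls M (\<lambda>x. g (h x))"
proof -
  have "AE x in M. k x = g (h x)"
    if "AE x in M. a x = g x" "b \<in> transformations M" "AE x in M. b x = h x" "AE x in M. k x = a (b x)" for a b k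
    using AE_transformation[OF that(2) that(1)] that(3,4) by eventually_elim simp
  note * = this
  have **: "g \<in> cls M g" "h \<in> cls M h" using g h by auto
  have "cls M g \<otimes>\<^bsub>Gms M\<^esub> cls M h = {k \<in> transformations M. \<exists>a\<in>cls M g. \<exists>b\<in>cls M h. AE x in M. k x = a (b x)}"
    by (simp add: Gms_def)
  also have "\<dots> = cls M (\<lambda>x. g (h x))"
  proof (intro Set.set_eqI iffI)
    fix k assume "k \<in> {k \<in> transformations M. \<exists>a\<in>cls M g. \<exists>b\<in>cls M h. AE x in M. k x = a (b x)}"
    then obtain a b where k: "k \<in> transformations M" "a \<in> cls M g" "b \<in> cls M h" "AE x in M. k x = a (b x)" by blast
    have "AE x in M. a x = g x" "b \<in> transformations M" "AE x in M. b x = h x" using k(2,3) by simp_all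
    from *[OF this k(4)] show "k \<in> cls M (\<lambda>x. g (h x))" using k(1) by simp
  next
    fix k assume "k \<in> cls M (\<lambda>x. g (h x))"
    then have "k \<in> transformations M" "AE x in M. k x = g (h x)" by simp_all
    then show "k \<in> {k \<in> transformations M. \<exists>a\<in>cls M g. \<exists>b\<in>cls M h. AE x in M. k x = a (b x)}"
      by (intro CollectI conjI bexI[OF _ **(1)] bexI[OF _ **(2)])
  qed
  finally show ?thesis .
qed

lemma cls_cong: "(\<And>x. x \<in> space M \<Longrightarrow> g x = h x) \<Longrightarrow> cls M g = cls M h"
  by (auto elim: AE_mp intro!: AE_I2)

lemma group_Gms: "group (Gms M)"
proof (rule groupI)
  have o: "\<one>\<^bsub>Gms M\<^esub> = cls M (\<lambda>x. x)" by (simp add: Gms_def)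
  show "\<one>\<^bsub>Gms M\<^esub> \<in> carrier (Gms M)" unfolding o by (rule cls_in[OF id_transformations])
  fix G assume "G \<in> carrier (Gms M)"
  then obtain g where g: "g \<in> transformations M" "G = cls M g" by (auto simp: carrier_Gms)
  show "\<one>\<^bsub>Gms M\<^esub> \<otimes>\<^bsub>Gms M\<^esub> G = G" using mult_Gms[OF id_transformations g(1)] by (simp add: o g)
  let ?i = "the_inv_into (space M) g"
  have "cls M ?i \<otimes>\<^bsub>Gms M\<^esub> G = cls M (\<lambda>x. ?i (g x))"
    using mult_Gms[OF the_inv_into_transformations[OF g(1)] g(1)] g(2) by simp
  also have "\<dots> = cls M (\<lambda>x. x)"
    using transformationsD(1)[OF g(1)] by (intro cls_cong) (auto simp: bij_betw_def the_inv_into_f_f)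
  finally show "\<exists>H\<in>carrier (Gms M). H \<otimes>\<^bsub>Gms M\<^esub> G = \<one>\<^bsub>Gms M\<^esub>"
    unfolding o[symmetric] using cls_in[OF the_inv_into_transformations[OF g(1)]] by blast
  fix H assume "H \<in> carrier (Gms M)"
  then obtain h where h: "h \<in> transformations M" "H = cls M h" by (auto simp: carrier_Gms)
  show "G \<otimes>\<^bsub>Gms M\<^esub> H \<in> carrier (Gms M)"
    unfolding g(2) h(2) mult_Gms[OF g(1) h(1)] by (rule cls_in[OF comp_transformations[OF g(1) h(1)]])
  fix K assume "K \<in> carrier (Gms M)"
  then obtain k where k: "k \<in> transformations M" "K = cls M k" by (auto simp: carrier_Gms)
  show "G \<otimes>\<^bsub>Gms M\<^esub> H \<otimes>\<^bsub>Gms M\<^esub> K = G \<otimes>\<^bsub>Gms M\<^esub> (H \<otimes>\<^bsub>Gms M\<^esub> K)"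
    unfolding g(2) h(2) k(2) mult_Gms[OF g(1) h(1)] mult_Gms[OF h(1) k(1)]
      mult_Gms[OF comp_transformations[OF g(1) h(1)] k(1)]
      mult_Gms[OF g(1) comp_transformations[OF h(1) k(1)]] ..
qed

lemma emeasure_kappa_rep:
  assumes g: "g \<in> transformations M" and A: "A \<in> sets M" and B: "B \<in> sets M" and E: "E \<in> sets pos_borel"
  shows "emeasure (kappa_rep M g A B) E = emeasure M {x \<in> space M. x \<in> A \<and> g x \<in> B \<and> RN M g x \<in> E}"
proof (rule emeasure_measure_of[OF kappa_rep_def])
  have rn: "RN M g \<in> borel_measurable M"
    unfolding RN_def by measurable
  have m: "{x \<in> space M. x \<in> A \<and> g x \<in> B \<and> RN M g x \<in> E} \<in> sets M" if "E \<in> sets pos_borel" for E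
  proof -
    have E: "E \<in> sets borel"
      using that by (auto simp: pos_borel_def sets_restrict_space)
    note [measurable] = transformationsD(2)[OF g] rn A B E
    show ?thesis by measurable
  qed
  show "sets pos_borel \<subseteq> Pow (space pos_borel)" by (simp add: sets.space_closed)
  show "E \<in> sets (kappa_rep M g A B)" using E
    by (simp add: kappa_rep_def sets.space_closed)
  show "positive (sets (kappa_rep M g A B)) (\<lambda>E. emeasure M {x \<in> space M. x \<in> A \<and> g x \<in> B \<and> RN M g x \<in> E})"
    by (auto simp: positive_def)
  show "countably_additive (sets (kappa_rep M g A B)) (\<lambda>E. emeasure M {x \<in> space M. x \<in> A \<and> g x \<in> B \<and> RN M g x \<in> E})"
  proof (rule countably_additiveI)
    fix F :: "nat \<Rightarrow> real set" assume F: "range F \<subseteq> sets (kappa_rep M g A B)" "disjoint_family F"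
    have s: "sets (kappa_rep M g A B) = sets pos_borel" by (simp add: kappa_rep_def sets.space_closed)
    have "(\<Sum>i. emeasure M {x \<in> space M. x \<in> A \<and> g x \<in> B \<and> RN M g x \<in> F i}) =
       emeasure M (\<Union>i. {x \<in> space M. x \<in> A \<and> g x \<in> B \<and> RN M g x \<in> F i})"
      using F m unfolding s by (intro suminf_emeasure) (auto simp: disjoint_family_on_def)
    also have "(\<Union>i. {x \<in> space M. x \<in> A \<and> g x \<in> B \<and> RN M g x \<in> F i}) = {x \<in> space M. x \<in> A \<and> g x \<in> B \<and> RN M g x \<in> (\<Union>i. F i)}" by auto
    finally show "(\<Sum>i. emeasure M {x \<in> space M. x \<in> A \<and> g x \<in> B \<and> RN M g x \<in> F i}) = emeasure M {x \<in> space M. x \<in> A \<and> g x \<in> B \<and> RN M g x \<in> \<Union>(range F)}" .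
  qed
qed

end

theory Submission
  imports Defs
begin

text \<open>The idea is to find a continuous section \<open>s\<close> from \<open>\<M>\<close> to \<open>Gms(M)\<close> such that \<open>s (\<Phi> g)\<close> lies in the
  closure of the double coset of \<open>g\<close>. Then \<open>q = f \<circ> s\<close> is continuous, and \<open>f g = q (\<Phi> g)\<close>, since \<open>f\<close> is
  constant on the double coset and limits in a metric space are unique. Passing to the closure is
  unavoidable: two transformations whose derivatives have the same distribution need not lie in
  one double coset, because one derivative may be injective and the other may take each value twice.

  The section. Identify \<open>M\<close> with the unit interval and let \<open>s \<nu>\<close> be the convex map of the interval
  onto itself whose derivative is the quantile function of \<open>\<nu>\<close>. If \<open>\<nu>\<^sub>n \<rightarrow> \<nu>\<close> weakly, the quantile functions
  converge almost everywhere (\<open>AE_quantile_tendsto\<close>), and as all of them have integral 1 they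
  converge in \<open>L\<^sup>1\<close> by Scheffe's lemma. This implies convergence of the transformations
  (\<open>limitin_Gms_topology\<close>, \<open>limitin_monotone_transformation\<close>), and hence continuity of \<open>s\<close>
  (\<open>continuous_map_monotone_transformation\<close>).

  The closure. If \<open>g' = h' \<circ> v\<close> with \<open>v\<close> measure-preserving, then \<open>g\<close> and \<open>h\<close> lie in one double coset
  (\<open>double_coset_of_RN\<close>). So \<open>g\<close> may be replaced by the increasing map with derivative \<open>g' \<circ> v\<close>,
  for any measure-preserving \<open>v\<close>, and it remains to choose \<open>v\<close> so that \<open>g' \<circ> v\<close> is uniformly close
  to the quantile function of \<open>\<Phi> g\<close> (\<open>approximate_sorting\<close>, \<open>double_coset_closure\<close>).

  All transformations come from one construction (\<open>ranking_transformation\<close>): rank the points of \<open>M\<close> by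
  a key that determines them, with respect to the measure with density \<open>w\<close>. Ranking by the
  coordinate gives the increasing map with derivative \<open>w\<close>. Ranking with \<open>w = 1\<close> by a key that
  consists of a discretized value of \<open>g'\<close> followed by the coordinate gives the approximate sorting.\<close>

section \<open>Quantile functions\<close>

definition unit_uniform :: "real measure" where
  "unit_uniform = uniform_measure lborel {0<..<1}"

text \<open>The generalized inverse of the distribution function. The value \<open>0\<close> outside the open unit
  interval makes it a Borel function on the whole line.\<close>

definition quantile :: "real measure \<Rightarrow> real \<Rightarrow> real" where
  "quantile \<nu> y = (if 0 < y \<and> y < 1 then Inf {t. y \<le> cdf \<nu> t} else 0)"

lemma space_unit_uniform [simp]: "space unit_uniform = UNIV"
  and sets_unit_uniform [simp, measurable_cong]: "sets unit_uniform = sets borel"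
  by (simp_all add: unit_uniform_def)

lemma prob_space_unit_uniform: "prob_space unit_uniform"
  unfolding unit_uniform_def by (rule prob_space_uniform_measure) auto

lemma AE_unit_uniform: "AE y in unit_uniform. 0 < y \<and> y < 1"
  unfolding unit_uniform_def by (rule AE_uniform_measureI) auto

lemma unit_uniform_singleton: "emeasure unit_uniform {y} = 0"
  using emeasure_mono[of "{0<..<1} \<inter> {y}" "{y}" lborel]
  by (simp add: unit_uniform_def uniform_measure_def emeasure_density)

lemma emeasure_unit_uniform:
  assumes "B \<in> sets borel"
  shows "emeasure unit_uniform B = emeasure lborel ({0<..<1} \<inter> B)"
  using assms by (simp add: unit_uniform_def divide_ennreal_def)

context real_distribution
begin

lemma quantile_le_iff: "0 < y \<Longrightarrow> y < 1 \<Longrightarrow> quantile M y \<le> t \<longleftrightarrow> y \<le> cdf M t"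
proof -
  interpret cdf_distribution M by unfold_locales
  show "0 < y \<Longrightarrow> y < 1 \<Longrightarrow> quantile M y \<le> t \<longleftrightarrow> y \<le> cdf M t"
    using pseudoinverse[of y t] by (simp add: quantile_def)
qed

lemma mono_on_quantile: "mono_on {0<..<1} (quantile M)"
proof (rule mono_onI)
  fix y z :: real assume yz: "y \<in> {0<..<1}" "z \<in> {0<..<1}" "y \<le> z"
  then have "z \<le> cdf M (quantile M z)" using quantile_le_iff[of z "quantile M z"] by simp
  then show "quantile M y \<le> quantile M z" using yz by (simp add: quantile_le_iff)
qed

lemma measurable_quantile [measurable]: "quantile M \<in> borel_measurable borel"
proof -
  interpret cdf_distribution M by unfold_locales
  have "(\<lambda>y. if y \<in> {0<..<1} then Inf {t. y \<le> cdf M t} else 0) \<in> borel_measurable borel"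
    by (subst measurable_If_restrict_space_iff) (use measurable_CI in \<open>auto simp: greaterThanLessThan_def greaterThan_def lessThan_def Int_def\<close>)
  then show ?thesis by (simp add: quantile_def[abs_def])
qed

lemma measurable_cdf [measurable]: "cdf M \<in> borel_measurable borel"
  by (intro borel_measurable_mono monoI cdf_nondecreasing)

lemma distr_quantile: "distr unit_uniform borel (quantile M) = M"
proof (rule measure_eqI)
  interpret cdf_distribution M by unfold_locales
  let ?\<Omega> = "restrict_space lborel {0<..<1::real}"
  fix B assume "B \<in> sets (distr unit_uniform borel (quantile M))"
  then have B: "B \<in> sets borel" by simp
  have mI: "(\<lambda>y. Inf {t. y \<le> cdf M t}) \<in> borel_measurable ?\<Omega>"
    using measurable_CI by (simp cong: measurable_cong_sets)
  have q: "quantile M -` B \<in> sets borel"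
    using measurable_sets[OF measurable_quantile B] by simp
  have "emeasure (distr unit_uniform borel (quantile M)) B
      = emeasure lborel ({0<..<1} \<inter> quantile M -` B)"
    using B q by (simp add: emeasure_distr emeasure_unit_uniform)
  also have "{0<..<1} \<inter> quantile M -` B = (\<lambda>y. Inf {t. y \<le> cdf M t}) -` B \<inter> space ?\<Omega>"
    by (auto simp: quantile_def space_restrict_space)
  also have "emeasure lborel \<dots> = emeasure ?\<Omega> \<dots>"
    by (subst emeasure_restrict_space) (auto simp: space_restrict_space)
  also have "\<dots> = emeasure (distr ?\<Omega> borel (\<lambda>y. Inf {t. y \<le> cdf M t})) B"
    using B mI by (simp add: emeasure_distr)
  also have "\<dots> = emeasure M B" by (simp only: distr_I_eq_M)
  finally show "emeasure (distr unit_uniform borel (quantile M)) B = emeasure M B" .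
qed (simp)

text \<open>Without atoms the distribution function is continuous, so it attains every level between 0
  and 1.\<close>

lemma cdf_quantile:
  assumes "\<And>t. measure M {t} = 0" and y: "0 < y" "y < 1"
  shows "cdf M (quantile M y) = y"
proof (rule antisym)
  show "y \<le> cdf M (quantile M y)" using quantile_le_iff[OF y, of "quantile M y"] by simp
  have "isCont (cdf M) (quantile M y)" using assms(1) by (simp add: isCont_cdf)
  then have "(cdf M \<longlongrightarrow> cdf M (quantile M y)) (at_left (quantile M y))"
    by (auto simp: isCont_def intro: tendsto_within_subset)
  then show "cdf M (quantile M y) \<le> y"
  proof (rule tendsto_upperbound)
    show "\<forall>\<^sub>F t in at_left (quantile M y). cdf M t \<le> y"
      unfolding eventually_at_left_field
    proof (intro exI[of _ "quantile M y - 1"] conjI allI impI)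
      fix t assume "t < quantile M y"
      then show "cdf M t \<le> y" using quantile_le_iff[OF y, of t] by linarith
    qed simp
  qed simp
qed

text \<open>The law itself is the image of the uniform law under the quantile function, so statements
  that hold almost everywhere for it can be checked along this function, where the previous lemma
  applies. Together the next two lemmas make the distribution function of a law without atoms an
  isomorphism mod 0 onto the unit interval.\<close>

lemma distr_cdf:
  assumes "\<And>t. measure M {t} = 0"
  shows "distr M borel (cdf M) = unit_uniform"
proof -
  have "distr M borel (cdf M) = distr (distr unit_uniform borel (quantile M)) borel (cdf M)"
    by (simp add: distr_quantile)
  also have "\<dots> = distr unit_uniform borel (cdf M \<circ> quantile M)"
    by (rule distr_distr) measurable
  also have "\<dots> = distr unit_uniform borel (\<lambda>y. y)"
  proof (rule distr_cong_AE)
    show "AE y in unit_uniform. (cdf M \<circ> quantile M) y = y"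
      using AE_unit_uniform by eventually_elim (simp add: cdf_quantile[OF assms])
  qed auto
  also have "\<dots> = unit_uniform" by (rule distr_id2) simp
  finally show ?thesis .
qed

lemma AE_quantile_cdf:
  assumes "\<And>t. measure M {t} = 0"
  shows "AE t in M. quantile M (cdf M t) = t"
proof -
  have "AE t in distr unit_uniform borel (quantile M). quantile M (cdf M t) = t"
  proof (subst AE_distr_iff)
    show "AE y in unit_uniform. quantile M (cdf M (quantile M y)) = quantile M y"
      using AE_unit_uniform by eventually_elim (simp add: cdf_quantile[OF assms])
  qed measurable
  then show ?thesis by (simp only: distr_quantile)
qed

lemma quantile_pos:
  assumes "AE t in M. 0 < t" and y: "0 < y" "y < 1"
  shows "0 < quantile M y"
proof (rule ccontr)
  assume "\<not> 0 < quantile M y"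
  then have "y \<le> cdf M 0" using quantile_le_iff[OF y, of 0] by simp
  moreover have "cdf M 0 = 0"
    unfolding cdf_def
  proof (rule measure_eq_0_null_sets)
    show "{..0} \<in> null_sets M"
      using assms(1) by (subst (asm) AE_iff_null) (auto simp: not_less atMost_def)
  qed
  ultimately show False using y by simp
qed

end

text \<open>Continuity points of the quantile function are precisely the levels at which the
  distribution function is not flat, and only there can a small perturbation of the law move the
  quantile by a large amount.\<close>

lemma quantile_tendsto:
  assumes D: "\<And>n. real_distribution (\<mu> n)" "real_distribution \<nu>"
    and conv: "weak_conv_m \<mu> \<nu>"
    and y: "0 < y" "y < 1" and cont: "isCont (quantile \<nu>) y"
  shows "(\<lambda>n. quantile (\<mu> n) y) \<longlonglongrightarrow> quantile \<nu> y"
proof (rule order_tendstoI)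
  interpret \<nu>: real_distribution \<nu> by fact
  have F: "(\<lambda>n. cdf (\<mu> n) x) \<longlonglongrightarrow> cdf \<nu> x" if "measure \<nu> {x} = 0" for x
    using conv that by (simp add: weak_conv_m_def weak_conv_def \<nu>.isCont_cdf)
  have ex: "\<exists>x. a < x \<and> x < b \<and> measure \<nu> {x} = 0" if "a < b" for a b
    using open_minus_countable[OF \<nu>.countable_support, of "{a<..<b}"] that by auto
  fix a assume "a < quantile \<nu> y"
  then obtain x where x: "a < x" "x < quantile \<nu> y" "measure \<nu> {x} = 0" using ex by blast
  then have "cdf \<nu> x < y" using \<nu>.quantile_le_iff[OF y, of x] by linarith
  from order_tendstoD(2)[OF F[OF x(3)] this]
  show "\<forall>\<^sub>F n in sequentially. a < quantile (\<mu> n) y"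
  proof eventually_elim
    case (elim n)
    then show ?case using x(1) real_distribution.quantile_le_iff[OF D(1) y, of n x] by linarith
  qed
next
  interpret \<nu>: real_distribution \<nu> by fact
  have F: "(\<lambda>n. cdf (\<mu> n) x) \<longlonglongrightarrow> cdf \<nu> x" if "measure \<nu> {x} = 0" for x
    using conv that by (simp add: weak_conv_m_def weak_conv_def \<nu>.isCont_cdf)
  have ex: "\<exists>x. a < x \<and> x < b \<and> measure \<nu> {x} = 0" if "a < b" for a b
    using open_minus_countable[OF \<nu>.countable_support, of "{a<..<b}"] that by auto
  fix a assume a: "quantile \<nu> y < a"
  have "(quantile \<nu> \<longlongrightarrow> quantile \<nu> y) (at_right y)"
    using cont by (auto simp: isCont_def intro: tendsto_within_subset)
  then have "\<forall>\<^sub>F z in at_right y. quantile \<nu> z < a" using a by (rule order_tendstoD)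
  moreover have "\<forall>\<^sub>F z in at_right y. y < z \<and> z < 1"
    using y by (auto simp: eventually_at_right_field)
  ultimately have "\<forall>\<^sub>F z in at_right y. quantile \<nu> z < a \<and> y < z \<and> z < 1" by eventually_elim simp
  then obtain z where z: "quantile \<nu> z < a" "y < z" "z < 1"
    by (metis (mono_tags, lifting) eventually_happens trivial_limit_at_right_real)
  then obtain x where x: "quantile \<nu> z < x" "x < a" "measure \<nu> {x} = 0" using ex by blast
  then have "y < cdf \<nu> x" using \<nu>.quantile_le_iff[of z x] z y by auto
  from order_tendstoD(1)[OF F[OF x(3)] this]
  show "\<forall>\<^sub>F n in sequentially. quantile (\<mu> n) y < a"
  proof eventually_elim
    case (elim n)
    then show ?case using x(2) real_distribution.quantile_le_iff[OF D(1) y, of n x] by linarith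
  qed
qed

text \<open>A monotone function has only countably many discontinuities.\<close>

lemma AE_quantile_tendsto:
  assumes D: "\<And>n. real_distribution (\<mu> n)" "real_distribution \<nu>"
    and conv: "weak_conv_m \<mu> \<nu>"
  shows "AE y in unit_uniform. (\<lambda>n. quantile (\<mu> n) y) \<longlonglongrightarrow> quantile \<nu> y"
proof -
  let ?D = "{y\<in>{0<..<1}. \<not> isCont (quantile \<nu>) y}"
  have "countable ?D"
    using mono_on_ctble_discont[OF real_distribution.mono_on_quantile[OF D(2)]]
    by (simp add: at_within_open[of _ "{0<..<1}"] cong: conj_cong)
  then have "?D \<in> null_sets lborel" by (rule countable_imp_null_set_lborel)
  then have "AE y in lborel. y \<notin> ?D" by (rule AE_not_in)
  then have "AE y in unit_uniform. y \<notin> ?D"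
    unfolding unit_uniform_def by (intro AE_uniform_measureI) auto
  with AE_unit_uniform show ?thesis
    by eventually_elim (auto intro!: quantile_tendsto[OF D conv])
qed

text \<open>If \<open>X \<le> Y + e\<close>, then \<open>Y \<le> t\<close> implies \<open>X \<le> t + e\<close>, so each quantile of \<open>X\<close> exceeds that of
  \<open>Y\<close> by at most \<open>e\<close>.\<close>

lemma quantile_close:
  assumes P: "prob_space M" and [measurable]: "X \<in> borel_measurable M" "Y \<in> borel_measurable M"
    and XY: "AE x in M. \<bar>X x - Y x\<bar> \<le> e" and y: "0 < y" "y < 1"
  shows "\<bar>quantile (distr M borel X) y - quantile (distr M borel Y) y\<bar> \<le> e"
proof -
  interpret prob_space M by fact
  have *: "quantile (distr M borel X) y \<le> quantile (distr M borel Y) y + e"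
    if [measurable]: "X \<in> borel_measurable M" "Y \<in> borel_measurable M"
      and XY: "AE x in M. \<bar>X x - Y x\<bar> \<le> e" for X Y :: "_ \<Rightarrow> real"
  proof -
    interpret X: real_distribution "distr M borel X" by (rule real_distribution_distr) fact
    interpret Y: real_distribution "distr M borel Y" by (rule real_distribution_distr) fact
    let ?t = "quantile (distr M borel Y) y"
    have "y \<le> cdf (distr M borel Y) ?t" using Y.quantile_le_iff[OF y, of ?t] by simp
    also have "\<dots> = prob {x\<in>space M. Y x \<le> ?t}"
      by (auto simp: cdf_def measure_distr vimage_def Int_def intro!: arg_cong[where f=prob])
    also have "\<dots> \<le> prob {x\<in>space M. X x \<le> ?t + e}"
      by (rule finite_measure_mono_AE) (use XY in \<open>eventually_elim, auto\<close>, measurable)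
    also have "\<dots> = cdf (distr M borel X) (?t + e)"
      by (auto simp: cdf_def measure_distr vimage_def Int_def intro!: arg_cong[where f=prob])
    finally show ?thesis using X.quantile_le_iff[OF y] by blast
  qed
  have YX: "AE x in M. \<bar>Y x - X x\<bar> \<le> e" using XY by eventually_elim (simp add: abs_minus_commute)
  show ?thesis using *[of X Y] *[of Y X] XY YX by auto
qed

text \<open>Countably many step functions detect weak convergence, because a distribution function is
  squeezed between integrals of steps with rational ends.\<close>

lemma weak_conv_m_rational_steps:
  assumes D: "\<And>n. real_distribution (\<mu> n)" "real_distribution \<nu>"
    and conv: "\<And>a b :: rat. a < b \<Longrightarrow>
      (\<lambda>n. \<integral>t. cts_step (of_rat a) (of_rat b) t \<partial>\<mu> n) \<longlonglongrightarrow> (\<integral>t. cts_step (of_rat a) (of_rat b) t \<partial>\<nu>)"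
  shows "weak_conv_m \<mu> \<nu>"
  unfolding weak_conv_m_def weak_conv_def
proof (intro allI impI order_tendstoI)
  interpret \<nu>: real_distribution \<nu> by fact
  fix x c assume cont: "isCont (cdf \<nu>) x"
  { assume c: "c < cdf \<nu> x"
    have "\<forall>\<^sub>F z in at_left x. c < cdf \<nu> z"
      using cont c by (auto simp: isCont_def intro: order_tendstoD tendsto_within_subset)
    then obtain z where z: "z < x" "\<And>w. z < w \<Longrightarrow> w < x \<Longrightarrow> c < cdf \<nu> w"
      by (auto simp: eventually_at_left_field)
    obtain a where a: "z < of_rat a" "of_rat a < x" using of_rat_dense[OF z(1)] by blast
    obtain b where b: "of_rat a < (of_rat b :: real)" "of_rat b < x" using of_rat_dense[OF a(2)] by blast
    have ab: "a < b" using b(1) by (simp add: of_rat_less)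
    have "c < (\<integral>t. cts_step (of_rat a) (of_rat b) t \<partial>\<nu>)"
      using z(2)[OF a] \<nu>.cdf_cts_step(1)[OF b(1)] by linarith
    from order_tendstoD(1)[OF conv[OF ab] this]
    show "\<forall>\<^sub>F n in sequentially. c < cdf (\<mu> n) x"
    proof eventually_elim
      case (elim n)
      interpret real_distribution "\<mu> n" by fact
      show ?case using elim cdf_cts_step(2)[OF b(1)] cdf_nondecreasing[of "of_rat b" x] b(2) by linarith
    qed }
  { assume c: "cdf \<nu> x < c"
    have "\<forall>\<^sub>F z in at_right x. cdf \<nu> z < c"
      using cont c by (auto simp: isCont_def intro: order_tendstoD tendsto_within_subset)
    then obtain z where z: "x < z" "\<And>w. x < w \<Longrightarrow> w < z \<Longrightarrow> cdf \<nu> w < c"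
      by (auto simp: eventually_at_right_field)
    obtain b where b: "x < of_rat b" "of_rat b < z" using of_rat_dense[OF z(1)] by blast
    obtain a where a: "x < of_rat a" "of_rat a < (of_rat b :: real)" using of_rat_dense[OF b(1)] by blast
    have ab: "a < b" using a(2) by (simp add: of_rat_less)
    have "(\<integral>t. cts_step (of_rat a) (of_rat b) t \<partial>\<nu>) < c"
      using z(2)[OF b] \<nu>.cdf_cts_step(2)[OF a(2)] by linarith
    from order_tendstoD(2)[OF conv[OF ab] this]
    show "\<forall>\<^sub>F n in sequentially. cdf (\<mu> n) x < c"
    proof eventually_elim
      case (elim n)
      interpret real_distribution "\<mu> n" by fact
      show ?case using elim cdf_cts_step(1)[OF a(2)] cdf_nondecreasing[of x "of_rat a"] a(1) by linarith
    qed }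
qed

section \<open>Transformations from inverses mod 0\<close>

lemma AE_comp_nonsingular:
  assumes S: "S \<in> M \<rightarrow>\<^sub>M N" and ns: "\<And>Z. Z \<in> null_sets N \<Longrightarrow> S -` Z \<inter> space M \<in> null_sets M"
    and P: "AE y in N. P y"
  shows "AE x in M. P (S x)"
proof -
  obtain Z where Z: "{y \<in> space N. \<not> P y} \<subseteq> Z" "Z \<in> null_sets N"
    using P by (auto elim!: AE_E intro: null_setsI)
  have "{x \<in> space M. \<not> P (S x)} \<subseteq> S -` Z \<inter> space M"
    using Z(1) measurable_space[OF S] by auto
  then show ?thesis by (rule AE_I'[OF ns[OF Z(2)]])
qed

lemma transformationsI:
  assumes g: "g \<in> M \<rightarrow>\<^sub>M M" and h: "h \<in> M \<rightarrow>\<^sub>M M"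
    and hg: "\<And>x. x \<in> space M \<Longrightarrow> h (g x) = x" and gh: "\<And>x. x \<in> space M \<Longrightarrow> g (h x) = x"
    and ng: "\<And>Z. Z \<in> null_sets M \<Longrightarrow> g -` Z \<inter> space M \<in> null_sets M"
    and nh: "\<And>Z. Z \<in> null_sets M \<Longrightarrow> h -` Z \<inter> space M \<in> null_sets M"
  shows "g \<in> transformations M"
proof -
  have gs: "g x \<in> space M" and hs: "h x \<in> space M" if "x \<in> space M" for x
    using measurable_space[OF g that] measurable_space[OF h that] by auto
  have b: "bij_betw g (space M) (space M)"
    by (rule bij_betw_byWitness[where f'=h]) (use hg gh gs hs in auto)
  have i: "the_inv_into (space M) g x = h x" if "x \<in> space M" for x
    using b that gh hs by (intro the_inv_into_f_eq) (auto simp: bij_betw_def)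
  have "the_inv_into (space M) g \<in> M \<rightarrow>\<^sub>M M"
    using h by (subst measurable_cong[OF i]) auto
  moreover have "g ` Z \<in> null_sets M" if "Z \<in> null_sets M" for Z
  proof -
    have "Z \<subseteq> space M" using that by (meson null_setsD2 sets.sets_into_space)
    then have "g ` Z = h -` Z \<inter> space M" using hg gh gs by (force simp: image_iff)
    then show ?thesis using nh[OF that] by simp
  qed
  ultimately show ?thesis using b g ng by (simp add: transformations_def)
qed

text \<open>Two maps that invert each other almost everywhere become honest inverse bijections on the
  set of points whose forward and backward orbits never meet the exceptional set. This set is
  invariant and conull, and outside of it the identity may be used, whatever the cardinality of
  the complement is.\<close>

lemma transformation_of_mod0_inverses:
  assumes M: "complete_measure M" and S: "S \<in> M \<rightarrow>\<^sub>M M" and T: "T \<in> M \<rightarrow>\<^sub>M M"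
    and nS: "\<And>Z. Z \<in> null_sets M \<Longrightarrow> S -` Z \<inter> space M \<in> null_sets M"
    and nT: "\<And>Z. Z \<in> null_sets M \<Longrightarrow> T -` Z \<inter> space M \<in> null_sets M"
    and TS: "AE x in M. T (S x) = x" and ST: "AE x in M. S (T x) = x"
  shows "\<exists>g\<in>transformations M. AE x in M. g x = S x"
proof -
  interpret complete_measure M by fact
  define X where "X = {x \<in> space M. \<forall>n. (T ((S ((S^^n) x))) = (S^^n) x \<and> S (T ((S^^n) x)) = (S^^n) x) \<and>
      (T (S ((T^^n) x)) = (T^^n) x \<and> S (T ((T^^n) x)) = (T^^n) x)}"
  let ?P = "\<lambda>x. T (S x) = x \<and> S (T x) = x"
  have P: "AE x in M. ?P x" using TS ST by eventually_elim simp
  have "AE x in M. ?P ((S^^n) x)" for n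
  proof (induction n)
    case (Suc n)
    have "AE x in M. ?P ((S^^n) (S x))" by (rule AE_comp_nonsingular[OF S nS Suc.IH])
    then show ?case by (simp only: funpow_Suc_right comp_apply)
  qed (use P in simp)
  moreover have "AE x in M. ?P ((T^^n) x)" for n
  proof (induction n)
    case (Suc n)
    have "AE x in M. ?P ((T^^n) (T x))" by (rule AE_comp_nonsingular[OF T nT Suc.IH])
    then show ?case by (simp only: funpow_Suc_right comp_apply)
  qed (use P in simp)
  ultimately have "AE x in M. \<forall>n. ?P ((S^^n) x) \<and> ?P ((T^^n) x)"
    by (simp add: AE_all_countable)
  then have X_AE: "AE x in M. x \<in> X" 
    by (auto simp: X_def elim!: AE_mp intro!: AE_I2)
  have X: "X \<in> sets M"
    by (rule in_sets_AE[of "space M"]) (use X_AE in \<open>auto simp: X_def\<close>)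
  have PX: "?P x" if "x \<in> X" for x
    using that unfolding X_def by (auto dest: spec[of _ 0])
  have SX: "S x \<in> X" if x: "x \<in> X" for x
  proof -
    have a: "?P ((S^^n) (S x))" for n
      using x unfolding X_def by (auto simp: funpow_swap1 dest: spec[of _ "Suc n"])
    have b: "?P ((T^^n) (S x))" for n
    proof (cases n)
      case 0
      then show ?thesis using a[of 0] by simp
    next
      case (Suc k)
      have "(T^^n) (S x) = (T^^k) x"
        using Suc PX[OF x] by (simp only: funpow_Suc_right comp_apply)
      then show ?thesis using x unfolding X_def by auto
    qed
    show ?thesis unfolding X_def using a b x measurable_space[OF S, of x] by (auto simp: X_def)
  qed
  have TX: "T x \<in> X" if x: "x \<in> X" for x
  proof -
    have a: "?P ((T^^n) (T x))" for n
      using x unfolding X_def by (auto simp: funpow_swap1 dest: spec[of _ "Suc n"])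
    have b: "?P ((S^^n) (T x))" for n
    proof (cases n)
      case 0
      then show ?thesis using a[of 0] by simp
    next
      case (Suc k)
      have "(S^^n) (T x) = (S^^k) x"
        using Suc PX[OF x] by (simp only: funpow_Suc_right comp_apply)
      then show ?thesis using x unfolding X_def by auto
    qed
    show ?thesis unfolding X_def using a b x measurable_space[OF T, of x] by (auto simp: X_def)
  qed
  define g where "g x = (if x \<in> X then S x else x)" for x
  define h where "h x = (if x \<in> X then T x else x)" for x
  have gS: "AE x in M. g x = S x" and hT: "AE x in M. h x = T x"
    using X_AE by (auto simp: g_def h_def elim: AE_mp)
  have null: "k -` Z \<inter> space M \<in> null_sets M"
    if "AE x in M. k x = R x" "R -` Z \<inter> space M \<in> null_sets M" for k R Z
  proof -
    have "AE x in M. x \<notin> R -` Z \<inter> space M" using that(2) by (rule AE_not_in)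
    with that(1) have "AE x in M. x \<notin> k -` Z \<inter> space M" by eventually_elim auto
    then show ?thesis by (simp add: null_sets_iff_AE)
  qed
  have "g \<in> transformations M"
  proof (rule transformationsI[where h=h])
    show "g \<in> M \<rightarrow>\<^sub>M M" "h \<in> M \<rightarrow>\<^sub>M M"
      unfolding g_def h_def using X S T by (auto intro!: measurable_If)
    show "h (g x) = x" "g (h x) = x" for x
      using SX TX PX by (auto simp: g_def h_def)
  qed (use null[OF gS nS] null[OF hT nT] in auto)
  then show ?thesis using gS by blast
qed

section \<open>Radon-Nikodym derivatives and double cosets\<close>

context prob_space
begin

lemma measurable_RN [measurable]: "RN M g \<in> borel_measurable M"
  unfolding RN_def by measurable

lemma RN_nonneg: "0 \<le> RN M g x"
  by (simp add: RN_def)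

lemma density_RN:
  assumes g: "g \<in> transformations M"
  shows "density M (RN M g) = distr M M (the_inv_into (space M) g)" (is "_ = ?D")
proof -
  have ac: "absolutely_continuous M ?D"
    unfolding absolutely_continuous_def
  proof
    fix Z assume Z: "Z \<in> null_sets M"
    then show "Z \<in> null_sets ?D"
      using emeasure_distr_inv(2)[OF g] transformationsD(4)[OF g Z] by (simp add: null_sets_def)
  qed
  interpret D: prob_space ?D by (rule prob_space_distr[OF transformationsD(3)[OF g]])
  have "AE x in M. RN_deriv M ?D x \<noteq> \<infinity>"
    by (rule RN_deriv_finite[OF _ ac]) (auto intro: D.sigma_finite_measure_axioms)
  then have "density M (RN M g) = density M (RN_deriv M ?D)"
    by (intro density_cong) (auto simp: RN_def top.not_eq_extremum elim!: AE_mp)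
  also have "\<dots> = ?D" by (rule density_RN_deriv[OF ac]) simp
  finally show ?thesis .
qed

text \<open>This identity and its converse \<open>RN_unique\<close> characterize the derivative without mentioning
  images of sets: \<open>g\<close> carries the measure with density \<open>g'\<close> to \<open>\<mu>\<close>.\<close>

lemma distr_density_RN:
  assumes g: "g \<in> transformations M"
  shows "distr (density M (RN M g)) M g = M"
proof -
  note b = transformationsD(1)[OF g]
  have "distr (density M (RN M g)) M g = distr (distr M M (the_inv_into (space M) g)) M g"
    by (simp only: density_RN[OF g])
  also have "\<dots> = distr M M (g \<circ> the_inv_into (space M) g)"
    using transformationsD(2,3)[OF g] by (intro distr_distr) auto
  also have "\<dots> = distr M M (\<lambda>x. x)"
    using f_the_inv_into_f_bij_betw[OF b] by (intro distr_cong) auto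
  also have "\<dots> = M" by (rule distr_id)
  finally show ?thesis .
qed

lemma RN_unique:
  assumes g: "g \<in> transformations M" and [measurable]: "w \<in> borel_measurable M"
    and w: "AE x in M. 0 \<le> w x" and d: "distr (density M w) M g = M"
  shows "AE x in M. RN M g x = w x"
proof -
  let ?i = "the_inv_into (space M) g"
  note b = transformationsD(1)[OF g]
  have "distr M M ?i = distr (distr (density M w) M g) M ?i" by (simp only: d)
  also have "\<dots> = distr (density M w) M (?i \<circ> g)"
    using transformationsD(2,3)[OF g] by (intro distr_distr) auto
  also have "\<dots> = distr (density M w) (density M w) (\<lambda>x. x)"
    using the_inv_into_f_f[of g "space M"] b by (intro distr_cong) (auto simp: bij_betw_def)
  also have "\<dots> = density M w" by (rule distr_id)
  finally have "density M w = distr M M ?i" by simp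
  then have "AE x in M. ennreal (w x) = RN_deriv M (distr M M ?i) x"
    by (intro RN_deriv_unique) auto
  with w show ?thesis by eventually_elim (metis RN_def enn2real_ennreal)
qed

lemma nn_integral_RN:
  assumes g: "g \<in> transformations M"
  shows "(\<integral>\<^sup>+x. RN M g x \<partial>M) = 1"
proof -
  have "(\<integral>\<^sup>+x. RN M g x \<partial>M) = emeasure (density M (RN M g)) (space M)"
    by (subst emeasure_density) (auto intro!: nn_integral_cong)
  also have "\<dots> = emeasure (distr (density M (RN M g)) M g) (space M)"
    using transformationsD(1)[OF g] transformationsD(2)[OF g]
    by (subst emeasure_distr) (auto simp: bij_betw_def intro!: arg_cong[where f="emeasure _"])
  also have "\<dots> = 1" by (simp only: distr_density_RN[OF g] emeasure_space_1)
  finally show ?thesis .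
qed

text \<open>The image of the zero set \<open>Z\<close> of the derivative has measure \<open>\<integral>\<^sub>Z g' = 0\<close>, so \<open>Z\<close> is null.\<close>

lemma AE_RN_pos:
  assumes g: "g \<in> transformations M"
  shows "AE x in M. 0 < RN M g x"
proof -
  let ?Z = "{x\<in>space M. RN M g x = 0}"
  have Z: "?Z \<in> sets M" by measurable
  have "emeasure M (g ` ?Z) = emeasure (density M (RN M g)) ?Z"
    unfolding density_RN[OF g] by (rule emeasure_distr_inv(2)[OF g Z, symmetric])
  also have "\<dots> = 0"
    by (subst emeasure_density) (auto simp: nn_integral_0_iff_AE indicator_def)
  finally have "g ` ?Z \<in> null_sets M" using emeasure_distr_inv(1)[OF g Z] by auto
  then have "g -` (g ` ?Z) \<inter> space M \<in> null_sets M" by (rule transformationsD(5)[OF g])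
  then have "?Z \<in> null_sets M"
    by (rule null_sets_subset) (use Z in auto)
  then have "AE x in M. x \<notin> ?Z" by (rule AE_not_in)
  then show ?thesis
  proof (rule AE_mp, intro AE_I2 impI)
    fix x assume "x \<in> space M" "x \<notin> ?Z"
    then show "0 < RN M g x" using RN_nonneg[of g x] by auto
  qed
qed

lemma density_comp:
  assumes v: "v \<in> M \<rightarrow>\<^sub>M M" "distr M M v = M" and [measurable]: "w \<in> borel_measurable M"
  shows "distr (density M (\<lambda>x. ennreal (w (v x)))) M v = density M w"
proof -
  have "density M w = density (distr M M v) w" by (simp only: v)
  also have "\<dots> = distr (density M (\<lambda>x. ennreal (w (v x)))) M v"
    using v by (subst density_distr) auto
  finally show ?thesis by simp
qed

lemma distr_the_inv_into:
  assumes v: "v \<in> transformations M" "distr M M v = M"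
  shows "distr M M (the_inv_into (space M) v) = M"
proof -
  let ?i = "the_inv_into (space M) v"
  have "distr M M ?i = distr (distr M M v) M ?i" by (simp only: v)
  also have "\<dots> = distr M M (?i \<circ> v)"
    using transformationsD(2,3)[OF v(1)] by (intro distr_distr) auto
  also have "\<dots> = distr M M (\<lambda>x. x)"
    using transformationsD(1)[OF v(1)] by (intro distr_cong) (auto simp: bij_betw_def the_inv_into_f_f)
  finally show ?thesis by (simp add: distr_id)
qed

lemma RN_comp_measure_preserving:
  assumes h: "h \<in> transformations M" and v: "v \<in> transformations M" "distr M M v = M"
  shows "AE x in M. RN M (\<lambda>x. h (v x)) x = RN M h (v x)"
proof (rule RN_unique)
  note [measurable] = transformationsD(2)[OF v(1)] transformationsD(2)[OF h]
  show "(\<lambda>x. h (v x)) \<in> transformations M" by (rule comp_transformations) fact+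
  show "(\<lambda>x. RN M h (v x)) \<in> borel_measurable M" by measurable
  show "AE x in M. 0 \<le> RN M h (v x)" by (simp add: RN_nonneg)
  have "distr (density M (\<lambda>x. RN M h (v x))) M (\<lambda>x. h (v x)) =
      distr (distr (density M (\<lambda>x. RN M h (v x))) M v) M h"
    by (subst distr_distr) (auto simp: comp_def)
  also have "\<dots> = M"
    by (simp only: density_comp[OF transformationsD(2)[OF v(1)] v(2) measurable_RN] distr_density_RN[OF h])
  finally show "distr (density M (\<lambda>x. RN M h (v x))) M (\<lambda>x. h (v x)) = M" .
qed

text \<open>The derivative determines a transformation up to a measure-preserving factor on the left:
  if \<open>g\<close> and \<open>k = h \<circ> v\<close> have the same derivative, then \<open>\<mu>(gA) = \<mu>(kA)\<close> for all \<open>A\<close>, and therefore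
  \<open>g k\<^sup>-\<^sup>1\<close> preserves \<open>\<mu>\<close>.\<close>

lemma double_coset_of_RN:
  assumes g: "g \<in> transformations M" and h: "h \<in> transformations M"
    and v: "v \<in> transformations M" "distr M M v = M"
    and RN: "AE x in M. RN M g x = RN M h (v x)"
  shows "\<exists>u\<in>Ams M. \<exists>v'\<in>Ams M. cls M g = u \<otimes>\<^bsub>Gms M\<^esub> cls M h \<otimes>\<^bsub>Gms M\<^esub> v'"
proof -
  define k where "k = (\<lambda>x. h (v x))"
  have k: "k \<in> transformations M" unfolding k_def by (rule comp_transformations) fact+
  let ?i = "the_inv_into (space M) k"
  have i: "?i \<in> transformations M" by (rule the_inv_into_transformations[OF k])
  define u where "u = (\<lambda>x. g (?i x))"
  have u: "u \<in> transformations M" unfolding u_def by (rule comp_transformations) fact+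
  have mgi: "g \<in> M \<rightarrow>\<^sub>M M" "?i \<in> M \<rightarrow>\<^sub>M M" by (rule transformationsD(2), fact)+
  have eq: "AE x in M. RN M k x = RN M g x"
    using RN RN_comp_measure_preserving[OF h v] unfolding k_def by eventually_elim simp
  have "distr M M u = distr (distr M M ?i) M g"
    unfolding u_def using mgi by (subst distr_distr) (auto simp: comp_def)
  also have "distr M M ?i = density M (RN M k)" by (rule density_RN[OF k, symmetric])
  also have "\<dots> = density M (RN M g)"
    by (rule density_cong) (use eq in \<open>auto elim!: AE_mp\<close>)
  finally have uM: "distr M M u = M" by (simp only: distr_density_RN[OF g])
  have A: "cls M w \<in> Ams M" if "w \<in> transformations M" "distr M M w = M" for w
    unfolding Ams_def using that by (subst Image_ae_eq[symmetric]) (auto intro: quotientI)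
  have "cls M u \<otimes>\<^bsub>Gms M\<^esub> cls M h \<otimes>\<^bsub>Gms M\<^esub> cls M v = cls M (\<lambda>x. u (h (v x)))"
    unfolding mult_Gms[OF u h] by (rule mult_Gms[OF comp_transformations[OF u h] v(1)])
  also have "\<dots> = cls M g"
  proof (rule cls_cong)
    fix x assume "x \<in> space M"
    then show "u (h (v x)) = g x"
      using the_inv_into_f_f[of k "space M" x] transformationsD(1)[OF k]
      by (simp add: u_def bij_betw_def) (simp add: k_def)
  qed
  finally show ?thesis using A[OF u uM] A[OF v] by force
qed

end

section \<open>Transformations by ranking\<close>

text \<open>An isomorphism mod 0 of \<open>M\<close> onto the unit interval, with inverse \<open>r\<close>. As \<open>M\<close> is complete,
  \<open>r\<close> is measurable only for the completed uniform law; \<open>p\<close> is a Borel function. Maps from \<open>M\<close> to \<open>M\<close>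
  are described below as \<open>r \<circ> X\<close> with a Borel function \<open>X\<close>, and completeness of \<open>M\<close> makes such a
  composition measurable if the law of \<open>X\<close> is absolutely continuous.\<close>

locale unit_coordinate = prob_space M + complete_measure M for M :: "'a measure" +
  fixes p :: "'a \<Rightarrow> real" and r :: "real \<Rightarrow> 'a"
  assumes p_borel [measurable]: "p \<in> borel_measurable M"
    and distr_p: "distr M borel p = unit_uniform"
    and r: "r \<in> completion unit_uniform \<rightarrow>\<^sub>M M"
    and rp: "AE x in M. r (p x) = x"
begin

lemma p_unit: "p \<in> M \<rightarrow>\<^sub>M unit_uniform"
  using p_borel by (simp cong: measurable_cong_sets)

lemma distr_p': "distr M unit_uniform p = unit_uniform"
  by (subst (2) distr_p[symmetric]) (rule distr_cong, auto)

lemma p_completion: "p \<in> M \<rightarrow>\<^sub>M completion unit_uniform"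
  by (rule measurable_completion2[OF p_unit]) (simp add: distr_p')

lemma distr_p_completion: "distr M (completion unit_uniform) p = completion unit_uniform"
  using completion_distr_eq[OF p_unit] by (simp add: distr_p')

lemma distr_r: "distr (completion unit_uniform) M r = M"
proof -
  have "distr (completion unit_uniform) M r = distr (distr M (completion unit_uniform) p) M r"
    by (simp only: distr_p_completion)
  also have "\<dots> = distr M M (r \<circ> p)"
    using r p_completion by (rule distr_distr)
  also have "\<dots> = distr M M (\<lambda>x. x)"
    using rp measurable_comp[OF p_completion r] by (intro distr_cong_AE) auto
  finally show ?thesis by (simp add: distr_id)
qed

lemma AE_p_r: "AE y in completion unit_uniform. p (r y) = y"
proof -
  have [measurable]: "(\<lambda>y. p (r y)) \<in> borel_measurable (completion unit_uniform)"
    using measurable_compose[OF r p_borel] .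
  have [measurable]: "(\<lambda>y. y) \<in> borel_measurable (completion unit_uniform)"
    by (rule measurable_completion) simp
  have "AE y in distr M (completion unit_uniform) p. p (r y) = y"
  proof (subst AE_distr_iff[OF p_completion])
    show "{y \<in> space (completion unit_uniform). p (r y) = y} \<in> sets (completion unit_uniform)"
      by measurable
    show "AE x in M. p (r (p x)) = p x" using rp by eventually_elim simp
  qed
  then show ?thesis by (simp only: distr_p_completion)
qed

lemma AE_p_unit: "AE x in M. 0 < p x \<and> p x < 1"
  using AE_unit_uniform unfolding distr_p[symmetric] by (subst (asm) AE_distr_iff) auto

lemma AE_comp_p:
  assumes "AE y in unit_uniform. P y"
  shows "AE x in M. P (p x)"
proof (rule AE_comp_nonsingular[OF p_unit _ assms])
  fix Z assume "Z \<in> null_sets unit_uniform"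
  then have "Z \<in> null_sets (distr M borel p)" by (simp only: distr_p)
  then show "p -` Z \<inter> space M \<in> null_sets M" by (simp add: null_sets_distr_iff)
qed

context
  fixes X :: "'a \<Rightarrow> real"
  assumes X [measurable]: "X \<in> borel_measurable M"
    and ac: "null_sets unit_uniform \<subseteq> null_sets (distr M borel X)"
begin

lemma nonsingular_completion: "X \<in> M \<rightarrow>\<^sub>M completion unit_uniform"
proof (rule measurable_completion2)
  show "X \<in> M \<rightarrow>\<^sub>M unit_uniform" using X by (simp cong: measurable_cong_sets)
  have "distr M unit_uniform X = distr M borel X" by (rule distr_cong) auto
  then show "null_sets unit_uniform \<subseteq> null_sets (distr M unit_uniform X)" using ac by simp
qed

lemma nonsingular_vimage:
  assumes "Z \<in> null_sets (completion unit_uniform)"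
  shows "X -` Z \<inter> space M \<in> null_sets M"
proof -
  obtain Z' where Z': "Z' \<in> null_sets unit_uniform" "Z \<subseteq> Z'"
    using assms by (auto simp: null_sets_completion_iff2)
  then have "X -` Z' \<inter> space M \<in> null_sets M"
    using ac by (auto simp: null_sets_distr_iff)
  then show ?thesis by (rule complete2[rotated]) (use Z' in auto)
qed

lemma measurable_r_comp: "(\<lambda>x. r (X x)) \<in> M \<rightarrow>\<^sub>M M"
  by (rule measurable_compose[OF nonsingular_completion r])

lemma nonsingular_r_comp:
  assumes "Z \<in> null_sets M"
  shows "(\<lambda>x. r (X x)) -` Z \<inter> space M \<in> null_sets M"
proof -
  have "Z \<in> null_sets (distr (completion unit_uniform) M r)" using assms by (simp only: distr_r)
  then have "r -` Z \<inter> space (completion unit_uniform) \<in> null_sets (completion unit_uniform)"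
    by (simp add: null_sets_distr_iff[OF r])
  from nonsingular_vimage[OF this] show ?thesis by (simp add: vimage_def)
qed

lemma AE_p_r_comp: "AE x in M. p (r (X x)) = X x"
  by (rule AE_comp_nonsingular[OF nonsingular_completion nonsingular_vimage AE_p_r])

end

text \<open>Let \<open>S' = r \<circ> S\<close> and \<open>T' = r \<circ> T\<close>. It is enough that \<open>T'\<close> is a left inverse of \<open>S'\<close>: then \<open>S' \<circ> T'\<close> is
  the identity on the range of \<open>S'\<close>, which is conull because every set whose preimage under \<open>S'\<close> is
  null is null.\<close>

lemma transformation_of_left_inverse:
  assumes S [measurable]: "S \<in> borel_measurable M"
    and nS: "null_sets (distr M borel S) = null_sets unit_uniform"
    and T [measurable]: "T \<in> borel_measurable M"
    and nT: "null_sets unit_uniform \<subseteq> null_sets (distr M borel T)"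
    and TS: "AE x in M. T (r (S x)) = p x"
  shows "\<exists>g\<in>transformations M. AE x in M. g x = r (S x)"
proof -
  have nS': "null_sets unit_uniform \<subseteq> null_sets (distr M borel S)" using nS by simp
  let ?S = "\<lambda>x. r (S x)" and ?T = "\<lambda>x. r (T x)"
  note mS [measurable] = measurable_r_comp[OF S nS']
  note mT [measurable] = measurable_r_comp[OF T nT]
  have TS': "AE x in M. ?T (?S x) = x" using TS rp by eventually_elim simp
  define E where "E = {y\<in>space M. p (?S (?T y)) \<noteq> p y}"
  have E: "E \<in> sets M" unfolding E_def by measurable
  let ?W = "r -` E \<inter> space (completion unit_uniform)"
  have W: "?W \<in> sets (completion unit_uniform)" by (rule measurable_sets[OF r E])
  have "AE x in M. S x \<notin> ?W" using TS' by eventually_elim (simp add: E_def)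
  then have "AE x in M. S x \<notin> main_part unit_uniform ?W"
    using main_part_null_part_Un[OF W] by (auto elim!: AE_mp)
  then have "main_part unit_uniform ?W \<in> null_sets (distr M borel S)"
    using main_part_sets[OF W] by (auto simp: null_sets_distr_iff null_sets_iff_AE)
  then have "emeasure unit_uniform (main_part unit_uniform ?W) = 0" using nS by auto
  then have "emeasure (completion unit_uniform) ?W = 0" using W by simp
  then have "emeasure (distr (completion unit_uniform) M r) E = 0"
    by (simp only: emeasure_distr[OF r E])
  then have "emeasure M E = 0" by (simp only: distr_r)
  then have "AE y in M. y \<notin> E" using E by (intro AE_not_in) auto
  moreover have "AE y in M. r (p y) = y" by (rule rp)
  moreover have "AE y in M. r (p (?S (?T y))) = ?S (?T y)"
  proof -
    have "AE y in M. r (p (?S y)) = ?S y"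
      by (rule AE_comp_nonsingular[OF mS nonsingular_r_comp[OF S nS'] rp])
    from AE_comp_nonsingular[OF mT nonsingular_r_comp[OF T nT] this] show ?thesis .
  qed
  ultimately have ST': "AE y in M. ?S (?T y) = y"
    using AE_space by eventually_elim (metis (mono_tags, lifting) E_def mem_Collect_eq)
  show ?thesis
    by (rule transformation_of_mod0_inverses[OF complete_measure_axioms mS mT
          nonsingular_r_comp[OF S nS'] nonsingular_r_comp[OF T nT] TS' ST'])
qed

text \<open>Ranking by a key. If a key determines the point, its law under the probability measure \<open>w\<mu>\<close>
  has no atoms, and the distribution function of that law carries it to the uniform law and is
  undone by the quantile function. So the rank of a point determines the point and is uniformly
  distributed under \<open>w\<mu>\<close>; read in the coordinate, it is a transformation that carries \<open>w\<mu>\<close> to \<open>\<mu>\<close>,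
  that is, with derivative \<open>w\<close>.\<close>

lemma ranking_transformation:
  fixes w k :: "'a \<Rightarrow> real" and d :: "real \<Rightarrow> real"
  assumes w [measurable]: "w \<in> borel_measurable M" and w_pos: "AE x in M. 0 < w x"
    and w_int: "(\<integral>\<^sup>+x. w x \<partial>M) = 1"
    and k [measurable]: "k \<in> borel_measurable M" and d [measurable]: "d \<in> borel_measurable borel"
    and dk: "AE x in M. d (k x) = p x"
  shows "\<exists>g\<in>transformations M. (AE x in M. RN M g x = w x) \<and>
    (AE x in M. p (g x) = cdf (distr (density M w) borel k) (k x)) \<and>
    (AE x in M. quantile (distr (density M w) borel k) (p (g x)) = k x)"
proof -
  let ?N = "density M w"
  have null: "null_sets ?N = null_sets M"
  proof (intro Set.set_eqI iffI)
    fix Z assume "Z \<in> null_sets M"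
    then show "Z \<in> null_sets ?N"
      using AE_not_in[of Z M] by (auto simp: null_sets_density_iff elim!: AE_mp)
  next
    fix Z assume "Z \<in> null_sets ?N"
    then have "Z \<in> sets M" "AE x in M. x \<in> Z \<longrightarrow> w x \<le> 0"
      by (auto simp: null_sets_density_iff ennreal_eq_0_iff)
    moreover from this(2) have "AE x in M. x \<notin> Z" using w_pos by eventually_elim auto
    ultimately show "Z \<in> null_sets M"
      using sets.sets_into_space by (auto simp: null_sets_iff_AE)
  qed
  have AE_N: "(AE x in M. P x) \<longleftrightarrow> (AE x in ?N. P x)" for P
    by (simp add: eventually_ae_filter null)
  interpret N: prob_space ?N
    by (rule prob_spaceI) (use w_int in \<open>auto simp: emeasure_density cong: nn_integral_cong\<close>)
  define \<Lambda> where "\<Lambda> = distr ?N borel k"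
  have distr_null: "null_sets (distr ?N borel X) = null_sets (distr M borel X)"
    if "X \<in> borel_measurable M" for X :: "'a \<Rightarrow> real"
    using that by (auto simp: null_sets_distr_iff null)
  interpret L: real_distribution \<Lambda> unfolding \<Lambda>_def by (rule N.real_distribution_distr) simp
  have atom: "measure \<Lambda> {t} = 0" for t
  proof -
    have "AE x in M. d t \<noteq> p x"
      by (rule AE_comp_p) (use unit_uniform_singleton[of "d t"] in \<open>auto intro!: AE_I[where N="{d t}"]\<close>)
    then have "AE x in M. k x \<noteq> t" using dk by eventually_elim auto
    then have "k -` {t} \<inter> space M \<in> null_sets M" by (subst null_sets_iff_AE) (auto elim: AE_mp)
    then have "{t} \<in> null_sets \<Lambda>" using null by (simp add: \<Lambda>_def null_sets_distr_iff)
    then show ?thesis by (rule measure_eq_0_null_sets)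
  qed
  let ?S = "\<lambda>x. cdf \<Lambda> (k x)" and ?T = "\<lambda>x. d (quantile \<Lambda> (p x))"
  have S_unif: "distr ?N borel ?S = unit_uniform"
  proof -
    have "distr ?N borel ?S = distr \<Lambda> borel (cdf \<Lambda>)"
      unfolding \<Lambda>_def[symmetric] by (subst (2) \<Lambda>_def) (simp add: distr_distr comp_def)
    then show ?thesis by (simp only: L.distr_cdf[OF atom])
  qed
  have mS: "?S \<in> borel_measurable M" and mT: "?T \<in> borel_measurable M" by measurable
  have nS: "null_sets (distr M borel ?S) = null_sets unit_uniform"
    using distr_null[OF mS] S_unif by simp
  have nT: "null_sets unit_uniform \<subseteq> null_sets (distr M borel ?T)"
  proof -
    have "distr M borel ?T = distr (distr (distr M borel p) borel (quantile \<Lambda>)) borel d"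
      by (simp add: distr_distr comp_def)
    also have "\<dots> = distr \<Lambda> borel d" by (simp only: distr_p L.distr_quantile)
    also have "\<dots> = distr ?N borel (d \<circ> k)" unfolding \<Lambda>_def by (rule distr_distr) auto
    also have "null_sets \<dots> = null_sets (distr M borel (d \<circ> k))" by (rule distr_null) measurable
    also have "distr M borel (d \<circ> k) = distr M borel p"
      using dk by (intro distr_cong_AE) auto
    finally show ?thesis by (simp only: distr_p)
  qed
  have nS': "null_sets unit_uniform \<subseteq> null_sets (distr M borel ?S)" by (simp only: nS)
  have prS: "AE x in M. p (r (?S x)) = ?S x" by (rule AE_p_r_comp[OF mS nS'])
  have "AE x in ?N. quantile \<Lambda> (cdf \<Lambda> (k x)) = k x"
    using L.AE_quantile_cdf[OF atom] unfolding \<Lambda>_def[symmetric]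
    by (subst (asm) (1) \<Lambda>_def, subst (asm) AE_distr_iff) auto
  then have qk: "AE x in M. quantile \<Lambda> (cdf \<Lambda> (k x)) = k x" by (simp only: AE_N)
  then have TS: "AE x in M. ?T (r (?S x)) = p x"
    using prS dk by eventually_elim simp
  obtain g where g: "g \<in> transformations M" "AE x in M. g x = r (?S x)"
    using transformation_of_left_inverse[OF mS nS mT nT TS] by blast
  have "distr ?N M g = distr ?N M (\<lambda>x. r (?S x))"
    using g measurable_r_comp[OF mS nS'] transformationsD(2)[OF g(1)]
    by (intro distr_cong_AE) (auto simp: AE_N[symmetric])
  also have "\<dots> = distr (distr ?N (completion unit_uniform) ?S) M r"
    using r nonsingular_completion[OF mS nS'] by (subst distr_distr) (auto simp: comp_def)
  also have "distr ?N (completion unit_uniform) ?S = completion unit_uniform"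
  proof -
    have "complete_measure ?N"
    proof
      fix A B :: "'a set" assume "B \<subseteq> A" "A \<in> null_sets ?N"
      then show "B \<in> sets ?N" using complete[of B A] null by simp
    qed
    then interpret NC: complete_measure ?N .
    have "distr ?N unit_uniform ?S = distr ?N borel ?S" by (rule distr_cong) auto
    then have u: "distr ?N unit_uniform ?S = unit_uniform" by (simp only: S_unif)
    have "?S \<in> ?N \<rightarrow>\<^sub>M unit_uniform" using mS by (simp cong: measurable_cong_sets)
    from NC.completion_distr_eq[OF this] show ?thesis by (simp add: u)
  qed
  also have "distr (completion unit_uniform) M r = M" by (rule distr_r)
  finally have "distr ?N M g = M" .
  then have "AE x in M. RN M g x = w x"
    using w_pos by (intro RN_unique[OF g(1) w]) (auto elim: AE_mp)
  moreover have pg: "AE x in M. p (g x) = ?S x" using g(2) prS by eventually_elim simp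
  moreover have "AE x in M. quantile \<Lambda> (p (g x)) = k x" using pg qk by eventually_elim simp
  ultimately show ?thesis using g(1) unfolding \<Lambda>_def by blast
qed

end

section \<open>Initial topologies and the measures of derivatives\<close>

lemma continuous_map_initial_topology:
  assumes "h \<in> F" "h ` S \<subseteq> topspace Y"
  shows "continuous_map (initial_topology S F Y) Y h"
  unfolding continuous_map_def
proof (intro conjI allI impI)
  show "h \<in> topspace (initial_topology S F Y) \<rightarrow> topspace Y" using assms(2) by auto
  fix U assume "openin Y U"
  then have "openin (initial_topology S F Y) (S \<inter> h -` U)"
    unfolding initial_topology_def using assms(1) by (intro topology_generated_by_Basis) auto
  then show "openin (initial_topology S F Y) {x \<in> topspace (initial_topology S F Y). h x \<in> U}"
    by (simp add: vimage_def Int_def)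
qed

lemma limitin_initial_topology:
  assumes l: "l \<in> S" and x: "\<And>n. x n \<in> S"
    and lim: "\<And>h. h \<in> F \<Longrightarrow> limitin Y (\<lambda>n. h (x n)) (h l) sequentially"
  shows "limitin (initial_topology S F Y) x l sequentially"
  unfolding limitin_def
proof (intro conjI allI impI)
  show "l \<in> topspace (initial_topology S F Y)" using l by simp
  fix U assume U: "openin (initial_topology S F Y) U \<and> l \<in> U"
  then have "generate_topology_on (insert S {S \<inter> h -` U | h U. h \<in> F \<and> openin Y U}) U"
    unfolding initial_topology_def by (auto dest: openin_topology_generated_by)
  moreover have "l \<in> U" using U by simp
  ultimately show "\<forall>\<^sub>F n in sequentially. x n \<in> U"
  proof induction
    case (Int a b)
    then show ?case by (auto simp: eventually_conj_iff)
  next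
    case (UN K)
    then obtain k where "k \<in> K" "l \<in> k" by blast
    with UN have "\<forall>\<^sub>F n in sequentially. x n \<in> k" by blast
    then show ?case by eventually_elim (use \<open>k \<in> K\<close> in blast)
  next
    case (Basis s)
    then consider "s = S" | h V where "h \<in> F" "openin Y V" "s = S \<inter> h -` V" by blast
    then show ?case
    proof cases
      case 2
      then have "\<forall>\<^sub>F n in sequentially. h (x n) \<in> V"
        using lim[OF 2(1)] Basis by (auto simp: limitin_def)
      then show ?thesis by eventually_elim (use 2 x in auto)
    qed (simp add: x)
  qed simp
qed

lemma sets_kappa_rep [simp]: "sets (kappa_rep M g A B) = sets pos_borel"
  by (simp add: kappa_rep_def sets.space_closed)

lemma space_kappa_rep [simp]: "space (kappa_rep M g A B) = {0<..}"
  using sets_eq_imp_space_eq[OF sets_kappa_rep, of M g A B]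
  by (simp add: pos_borel_def space_restrict_space)

lemma limitin_weak_topology:
  assumes "\<And>n. \<mu> n \<in> finite_pos_measures" "\<nu> \<in> finite_pos_measures"
    and "\<And>\<phi> :: real \<Rightarrow> real. continuous_on {0<..} \<phi> \<Longrightarrow> bounded (\<phi> ` {0<..}) \<Longrightarrow>
      (\<lambda>n. \<integral>t. \<phi> t \<partial>\<mu> n) \<longlonglongrightarrow> (\<integral>t. \<phi> t \<partial>\<nu>)"
  shows "limitin weak_topology \<mu> \<nu> sequentially"
  unfolding weak_topology_def by (rule limitin_initial_topology) (use assms in auto)

context prob_space
begin

lemma integrable_RN:
  assumes "g \<in> transformations M"
  shows "integrable M (RN M g)"
  using nn_integral_RN[OF assms] by (intro integrableI_nonneg) (auto simp: RN_nonneg)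

text \<open>Turns integrals with respect to \<open>\<kappa>\<close> into integrals over \<open>M\<close>. The points where the derivative
  vanishes form a null set, but they have to be cut out for the image to be a measure on the positive
  reals.\<close>

lemma kappa_rep_eq_distr:
  assumes g: "g \<in> transformations M" and A: "A \<in> sets M" and B: "B \<in> sets M"
  defines "Z \<equiv> {x\<in>space M. x \<in> A \<and> g x \<in> B \<and> 0 < RN M g x}"
  shows "Z \<in> sets M" "RN M g \<in> restrict_space M Z \<rightarrow>\<^sub>M pos_borel"
    "kappa_rep M g A B = distr (restrict_space M Z) pos_borel (RN M g)"
proof -
  note [measurable] = transformationsD(2)[OF g] A B
  show Z: "Z \<in> sets M" unfolding Z_def by measurable
  show m: "RN M g \<in> restrict_space M Z \<rightarrow>\<^sub>M pos_borel"
    unfolding pos_borel_def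
    by (rule measurable_restrict_space2) (auto simp: space_restrict_space Z_def intro: measurable_restrict_space1)
  show "kappa_rep M g A B = distr (restrict_space M Z) pos_borel (RN M g)"
  proof (rule measure_eqI)
    fix E assume "E \<in> sets (kappa_rep M g A B)"
    then have E: "E \<in> sets pos_borel" by simp
    then have Epos: "E \<subseteq> {0<..}" by (auto simp: pos_borel_def sets_restrict_space)
    have "emeasure (distr (restrict_space M Z) pos_borel (RN M g)) E
        = emeasure M (RN M g -` E \<inter> space (restrict_space M Z))"
      using Z by (subst emeasure_distr[OF m E], subst emeasure_restrict_space)
        (auto simp: space_restrict_space)
    also have "RN M g -` E \<inter> space (restrict_space M Z) = {x \<in> space M. x \<in> A \<and> g x \<in> B \<and> RN M g x \<in> E}"
      using Epos Z by (auto simp: space_restrict_space Z_def)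
    finally show "emeasure (kappa_rep M g A B) E = emeasure (distr (restrict_space M Z) pos_borel (RN M g)) E"
      by (simp only: emeasure_kappa_rep[OF g A B E])
  qed simp
qed

lemma integral_kappa_rep:
  assumes g: "g \<in> transformations M" and A: "A \<in> sets M" and B: "B \<in> sets M"
    and [measurable]: "h \<in> borel_measurable borel"
  shows "(\<integral>t. h t \<partial>kappa_rep M g A B) =
    (\<integral>x. indicator A x * indicator B (g x) * (h (RN M g x) :: real) \<partial>M)"
proof -
  let ?Z = "{x\<in>space M. x \<in> A \<and> g x \<in> B \<and> 0 < RN M g x}"
  note Z = kappa_rep_eq_distr[OF g A B]
  note [measurable] = transformationsD(2)[OF g] A B
  have "h \<in> borel_measurable pos_borel"
    unfolding pos_borel_def by (rule measurable_restrict_space1) simp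
  then have "(\<integral>t. h t \<partial>kappa_rep M g A B) = (\<integral>x. h (RN M g x) \<partial>restrict_space M ?Z)"
    unfolding Z(3) by (rule integral_distr[OF Z(2)])
  also have "\<dots> = (\<integral>x. indicator ?Z x *\<^sub>R h (RN M g x) \<partial>M)"
    using Z(1) by (subst integral_restrict_space) (auto simp: set_lebesgue_integral_def)
  also have "\<dots> = (\<integral>x. indicator A x * indicator B (g x) * h (RN M g x) \<partial>M)"
    using Z(1) AE_RN_pos[OF g] by (intro integral_cong_AE) (auto simp: indicator_def elim!: AE_mp)
  finally show ?thesis .
qed

lemma kappa_rep_finite:
  assumes g: "g \<in> transformations M" and A: "A \<in> sets M" and B: "B \<in> sets M"
  shows "kappa_rep M g A B \<in> finite_pos_measures" "tmult (kappa_rep M g A B) \<in> finite_pos_measures"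
proof -
  let ?Z = "{x\<in>space M. x \<in> A \<and> g x \<in> B \<and> 0 < RN M g x}"
  note Z = kappa_rep_eq_distr[OF g A B]
  have "finite_measure (restrict_space M ?Z)"
    using Z(1) by (intro finite_measure_restrict_space) auto
  then have "finite_measure (kappa_rep M g A B)"
    unfolding Z(3) by (rule finite_measure.finite_measure_distr[OF _ Z(2)])
  then show "kappa_rep M g A B \<in> finite_pos_measures" by (simp add: finite_pos_measures_def)
  have t: "(\<lambda>t. ennreal t) \<in> borel_measurable pos_borel"
    unfolding pos_borel_def by (rule measurable_restrict_space1) simp
  then have t': "(\<lambda>t. ennreal t) \<in> borel_measurable (kappa_rep M g A B)"
    by (simp cong: measurable_cong_sets)
  have "emeasure (tmult (kappa_rep M g A B)) (space (tmult (kappa_rep M g A B)))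
      = (\<integral>\<^sup>+t. ennreal t \<partial>kappa_rep M g A B)"
    unfolding tmult_def using t' sets.top[of "kappa_rep M g A B"] by (subst emeasure_density) (auto intro!: nn_integral_cong)
  also have "\<dots> = (\<integral>\<^sup>+x. RN M g x \<partial>restrict_space M ?Z)"
    unfolding Z(3) using t by (intro nn_integral_distr[OF Z(2)]) simp
  also have "\<dots> \<le> (\<integral>\<^sup>+x. RN M g x \<partial>M)"
    using Z(1) by (subst nn_integral_restrict_space) (auto intro!: nn_integral_mono simp: indicator_def)
  finally have "finite_measure (tmult (kappa_rep M g A B))"
    using nn_integral_RN[OF g] by (intro finite_measureI) (auto simp: top_unique)
  then show "tmult (kappa_rep M g A B) \<in> finite_pos_measures"
    by (simp add: finite_pos_measures_def tmult_def)
qed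

lemma integral_tmult_kappa_rep:
  assumes g: "g \<in> transformations M" and A: "A \<in> sets M" and B: "B \<in> sets M"
    and [measurable]: "h \<in> borel_measurable borel"
  shows "(\<integral>t. h t \<partial>tmult (kappa_rep M g A B)) = (\<integral>t. t * h t \<partial>kappa_rep M g A B)"
proof -
  have "h \<in> borel_measurable pos_borel" "(\<lambda>t. t) \<in> borel_measurable pos_borel"
    unfolding pos_borel_def by (rule measurable_restrict_space1, simp)+
  then have "h \<in> borel_measurable (kappa_rep M g A B)" "(\<lambda>t. t) \<in> borel_measurable (kappa_rep M g A B)"
    by (simp_all cong: measurable_cong_sets)
  then show ?thesis unfolding tmult_def by (subst integral_density) auto
qed

lemma integral_RN_indicator:
  assumes g: "g \<in> transformations M" and [measurable]: "B \<in> sets M"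
  shows "(\<integral>x. RN M g x * indicator B (g x) \<partial>M) = prob B"
proof -
  note [measurable] = transformationsD(2)[OF g]
  have "prob B = (\<integral>x. indicator B x \<partial>M)" by simp
  also have "\<dots> = (\<integral>x. indicator B x \<partial>distr (density M (RN M g)) M g)"
    by (simp only: distr_density_RN[OF g])
  also have "\<dots> = (\<integral>x. indicator B (g x) \<partial>density M (RN M g))"
    by (rule integral_distr) auto
  also have "\<dots> = (\<integral>x. RN M g x * indicator B (g x) \<partial>M)"
    by (subst integral_density) (auto simp: RN_nonneg)
  finally show ?thesis by simp
qed

lemma RN_L1_convergence:
  assumes g: "\<And>n. g n \<in> transformations M" and k: "k \<in> transformations M"
    and lim: "AE x in M. (\<lambda>n. RN M (g n) x) \<longlonglongrightarrow> RN M k x"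
  shows "(\<lambda>n. \<integral>x. \<bar>RN M (g n) x - RN M k x\<bar> \<partial>M) \<longlonglongrightarrow> 0"
proof -
  have "(\<lambda>n. \<integral>\<^sup>+x. norm (RN M (g n) x - RN M k x) \<partial>M) \<longlonglongrightarrow> 0"
    by (rule Scheffe_lemma2) (use lim integrable_RN[OF k] in \<open>auto simp: RN_nonneg nn_integral_RN[OF g] nn_integral_RN[OF k]\<close>)
  moreover have "(\<integral>\<^sup>+x. norm (RN M (g n) x - RN M k x) \<partial>M) = ennreal (\<integral>x. \<bar>RN M (g n) x - RN M k x\<bar> \<partial>M)" for n
    using integrable_RN[OF g] integrable_RN[OF k] by (subst nn_integral_eq_integral) auto
  ultimately have "(\<lambda>n. ennreal (\<integral>x. \<bar>RN M (g n) x - RN M k x\<bar> \<partial>M)) \<longlonglongrightarrow> ennreal 0" by simp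
  then show ?thesis by (subst (asm) tendsto_ennreal_iff) auto
qed

end

section \<open>A criterion for convergence of transformations\<close>

context unit_coordinate
begin

lemma outer_open_approx:
  assumes B: "B \<in> sets M" and e: "0 < e"
  shows "\<exists>V. open V \<and> (AE x in M. x \<in> B \<longrightarrow> p x \<in> V) \<and> prob {x\<in>space M. p x \<in> V \<and> x \<notin> B} < e"
proof -
  interpret U: prob_space unit_uniform by (rule prob_space_unit_uniform)
  let ?W = "r -` B \<inter> space (completion unit_uniform)"
  have W: "?W \<in> sets (completion unit_uniform)" by (rule measurable_sets[OF r B])
  let ?C = "main_part unit_uniform ?W"
  have C: "?C \<in> sets borel" using main_part_sets[OF W] by simp
  have W_C: "AE y in unit_uniform. y \<in> ?W \<longleftrightarrow> y \<in> ?C"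
    using AE_in_main_part[OF W] by eventually_elim auto
  have B_C: "AE x in M. x \<in> B \<longleftrightarrow> p x \<in> ?C"
    using AE_comp_p[OF W_C] rp by eventually_elim simp
  have "emeasure unit_uniform ?C = (INF V \<in> {V. ?C \<subseteq> V \<and> open V}. emeasure unit_uniform V)"
    by (rule outer_regular) (use C in auto)
  moreover have "emeasure unit_uniform ?C < emeasure unit_uniform ?C + ennreal e"
    using e by (simp add: U.emeasure_eq_measure ennreal_less_iff flip: ennreal_plus)
  ultimately obtain V where V: "?C \<subseteq> V" "open V" "emeasure unit_uniform V < emeasure unit_uniform ?C + ennreal e"
    by (auto simp: INF_less_iff)
  have 1: "AE x in M. x \<in> B \<longrightarrow> p x \<in> V" using B_C by eventually_elim (use V in auto)
  note [measurable] = B C borel_open[OF V(2)]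
  have "{x\<in>space M. p x \<in> V \<and> x \<notin> B} \<in> events" "{x\<in>space M. p x \<in> V - ?C} \<in> events"
    by measurable
  then have "prob {x\<in>space M. p x \<in> V \<and> x \<notin> B} = prob {x\<in>space M. p x \<in> V - ?C}"
    using B_C by (intro finite_measure_eq_AE) (auto elim!: AE_mp)
  also have "\<dots> = measure (distr M borel p) (V - ?C)"
    using C V by (subst measure_distr) (auto intro!: arg_cong[where f=prob])
  also have "\<dots> = measure unit_uniform V - measure unit_uniform ?C"
    unfolding distr_p using C V by (intro U.finite_measure_Diff) auto
  also have "\<dots> < e"
    using V(3) e by (simp add: U.emeasure_eq_measure ennreal_less_iff flip: ennreal_plus)
  finally show ?thesis using 1 V(2) by blast
qed

text \<open>Suppose first that \<open>B\<close> is open in the coordinate. Pointwise convergence shows that \<open>k x \<in> B\<close> implies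
  \<open>g n x \<in> B\<close> eventually, which takes care of the negative part of \<open>1\<^bsub>B\<^esub>(g n x) - 1\<^bsub>B\<^esub>(k x)\<close>. The positive
  part follows without further information on the points: \<open>\<integral> 1\<^bsub>B\<^esub>(g n x) (g n)'(x) dx = \<mu> B\<close> for all \<open>n\<close>, and as
  in Scheffe's lemma, equal integrals and a vanishing negative part force the positive part to vanish.
  Outer regularity extends this to all \<open>B\<close>.\<close>

lemma weighted_indicator_convergence:
  assumes g: "\<And>n. g n \<in> transformations M" and k: "k \<in> transformations M"
    and RN: "AE x in M. (\<lambda>n. RN M (g n) x) \<longlonglongrightarrow> RN M k x"
    and pt: "AE x in M. (\<lambda>n. p (g n x)) \<longlonglongrightarrow> p (k x)"
    and B: "B \<in> sets M"
  shows "(\<lambda>n. \<integral>x. \<bar>indicator B (g n x) - indicator B (k x)\<bar> * RN M k x \<partial>M) \<longlonglongrightarrow> 0"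
proof (rule LIMSEQ_I)
  fix e :: real assume e: "0 < e"
  note [measurable] = transformationsD(2)[OF g] transformationsD(2)[OF k] B
  let ?\<rho> = "RN M k"
  let ?I = "\<lambda>n. \<integral>x. \<bar>RN M (g n) x - ?\<rho> x\<bar> \<partial>M"
  note int [simp] = integrable_RN[OF k] integrable_RN[OF g]
  obtain V where V: "open V" "AE x in M. x \<in> B \<longrightarrow> p x \<in> V"
    "prob {x\<in>space M. p x \<in> V \<and> x \<notin> B} < e/8"
    using outer_open_approx[OF B, of "e/8"] e by auto
  have [measurable]: "V \<in> sets borel" using V(1) by simp
  define D where "D = {x\<in>space M. p x \<in> V \<and> x \<notin> B}"
  have [measurable]: "D \<in> sets M" unfolding D_def by measurable
  let ?c = "\<lambda>n x. max 0 (indicator V (p (k x)) - indicator V (p (g n x)) :: real)"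
  \<comment> \<open>Points with \<open>p (k x) \<in> V\<close> eventually satisfy \<open>p (g n x) \<in> V\<close>, because \<open>V\<close> is open.\<close>
  have c_lim: "(\<lambda>n. \<integral>x. ?c n x * ?\<rho> x \<partial>M) \<longlonglongrightarrow> (\<integral>x. 0 \<partial>M)"
  proof (rule integral_dominated_convergence[where w="?\<rho>"])
    show "AE x in M. (\<lambda>n. ?c n x * ?\<rho> x) \<longlonglongrightarrow> 0"
      using pt
    proof eventually_elim
      case (elim x)
      have "\<forall>\<^sub>F n in sequentially. ?c n x * ?\<rho> x = 0"
      proof (cases "p (k x) \<in> V")
        case True
        with topological_tendstoD[OF elim V(1)] show ?thesis by (auto elim: eventually_mono)
      qed (auto simp: indicator_def)
      then show ?case by (rule tendsto_eventually)
    qed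
    show "AE x in M. norm (?c n x * ?\<rho> x) \<le> ?\<rho> x" for n
      by (auto simp: RN_nonneg abs_mult indicator_def)
  qed auto
  have bound: "(\<integral>x. \<bar>indicator B (g n x) - indicator B (k x)\<bar> * ?\<rho> x \<partial>M)
      \<le> 3 * ?I n + 2 * (\<integral>x. ?c n x * ?\<rho> x \<partial>M) + e/4" for n
  proof -
    let ?a = "\<lambda>x. indicator B (g n x) :: real" and ?b = "\<lambda>x. indicator B (k x) :: real"
    let ?d = "\<lambda>x. indicator D (g n x) :: real"
    have i1: "integrable M (\<lambda>x. F x * ?\<rho> x)" "integrable M (\<lambda>x. RN M (g n) x * F x)"
      if [measurable]: "F \<in> borel_measurable M" and "\<And>x. \<bar>F x\<bar> \<le> 1" for F :: "'a \<Rightarrow> real"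
    proof -
      have *: "integrable M (\<lambda>x. F x * G x)" if G: "integrable M G" for G :: "'a \<Rightarrow> real"
        by (rule Bochner_Integration.integrable_bound[OF G])
           (use \<open>\<And>x. \<bar>F x\<bar> \<le> 1\<close> borel_measurable_integrable[OF G] in \<open>auto simp: abs_mult intro!: mult_left_le_one_le\<close>)
      show "integrable M (\<lambda>x. F x * ?\<rho> x)" by (rule *) simp
      show "integrable M (\<lambda>x. RN M (g n) x * F x)"
        using *[of "RN M (g n)"] by (simp add: mult.commute)
    qed
    have kV: "AE x in M. k x \<in> B \<longrightarrow> p (k x) \<in> V"
      by (rule AE_transformation[OF k V(2)])
    have iabs: "integrable M (\<lambda>x. \<bar>?a x - ?b x\<bar> * ?\<rho> x)"
      and iab: "integrable M (\<lambda>x. (?a x - ?b x) * ?\<rho> x)"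
      and ic: "integrable M (\<lambda>x. ?c n x * ?\<rho> x)"
      and id: "integrable M (\<lambda>x. ?d x * ?\<rho> x)"
      and ia: "integrable M (\<lambda>x. ?a x * ?\<rho> x)" and ib: "integrable M (\<lambda>x. ?b x * ?\<rho> x)"
      by (rule i1(1); auto simp: indicator_def)+
    have iga: "integrable M (\<lambda>x. RN M (g n) x * ?a x)" and igd: "integrable M (\<lambda>x. RN M (g n) x * ?d x)"
      by (rule i1(2); auto simp: indicator_def)+
    have iI: "integrable M (\<lambda>x. \<bar>RN M (g n) x - ?\<rho> x\<bar>)" by auto
    \<comment> \<open>The absolute value is the difference \<open>a - b\<close> plus twice the negative part. The latter is at most
      \<open>c n\<close>, except where \<open>g n x\<close> lies in the gap \<open>D\<close> between \<open>B\<close> and the open set.\<close>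
    have "(\<integral>x. \<bar>?a x - ?b x\<bar> * ?\<rho> x \<partial>M) \<le> (\<integral>x. (?a x - ?b x) * ?\<rho> x + 2 * (?c n x * ?\<rho> x) + 2 * (?d x * ?\<rho> x) \<partial>M)"
    proof (rule integral_mono_AE[OF iabs])
      show "AE x in M. \<bar>?a x - ?b x\<bar> * ?\<rho> x \<le> (?a x - ?b x) * ?\<rho> x + 2 * (?c n x * ?\<rho> x) + 2 * (?d x * ?\<rho> x)"
        using kV AE_space
      proof eventually_elim
        case (elim x)
        have "g n x \<in> space M" using measurable_space[OF transformationsD(2)[OF g] elim(2)] .
        then have "\<bar>?a x - ?b x\<bar> \<le> (?a x - ?b x) + 2 * ?c n x + 2 * ?d x"
          using elim(1) by (auto simp: indicator_def D_def)
        then have "\<bar>?a x - ?b x\<bar> * ?\<rho> x \<le> ((?a x - ?b x) + 2 * ?c n x + 2 * ?d x) * ?\<rho> x"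
          by (rule mult_right_mono) (rule RN_nonneg)
        then show ?case by (simp only: distrib_right mult.assoc)
      qed
      show "integrable M (\<lambda>x. (?a x - ?b x) * ?\<rho> x + 2 * (?c n x * ?\<rho> x) + 2 * (?d x * ?\<rho> x))"
        using iab ic id by simp
    qed
    also have "\<dots> = (\<integral>x. (?a x - ?b x) * ?\<rho> x \<partial>M) + 2 * (\<integral>x. ?c n x * ?\<rho> x \<partial>M) + 2 * (\<integral>x. ?d x * ?\<rho> x \<partial>M)"
      using iab ic id by simp
    finally have 1: "(\<integral>x. \<bar>?a x - ?b x\<bar> * ?\<rho> x \<partial>M) \<le> \<dots>" .
    \<comment> \<open>Both \<open>g n\<close> and \<open>k\<close> give the same value \<open>\<mu> B\<close> for the integral against their own derivative.\<close>
    have 2: "(\<integral>x. (?a x - ?b x) * ?\<rho> x \<partial>M) \<le> ?I n"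
    proof -
      have "(\<integral>x. ?b x * ?\<rho> x \<partial>M) = (\<integral>x. RN M (g n) x * ?a x \<partial>M)"
        using integral_RN_indicator[OF k B] integral_RN_indicator[OF g B, of n] by (simp add: mult.commute)
      then have "(\<integral>x. (?a x - ?b x) * ?\<rho> x \<partial>M) = (\<integral>x. ?a x * ?\<rho> x \<partial>M) - (\<integral>x. RN M (g n) x * ?a x \<partial>M)"
        using ia ib by (simp add: left_diff_distrib)
      also have "\<dots> = (\<integral>x. ?a x * ?\<rho> x - RN M (g n) x * ?a x \<partial>M)"
        using ia iga by simp
      also have "\<dots> \<le> ?I n"
        using ia iga iI by (intro integral_mono) (auto simp: indicator_def)
      finally show ?thesis .
    qed
    have 3: "(\<integral>x. ?d x * ?\<rho> x \<partial>M) \<le> ?I n + e/8"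
    proof -
      have "(\<integral>x. ?d x * ?\<rho> x \<partial>M) \<le> (\<integral>x. \<bar>RN M (g n) x - ?\<rho> x\<bar> + RN M (g n) x * ?d x \<partial>M)"
      proof (rule integral_mono[OF id])
        show "integrable M (\<lambda>x. \<bar>RN M (g n) x - ?\<rho> x\<bar> + RN M (g n) x * ?d x)"
          using iI igd by (rule Bochner_Integration.integrable_add)
      qed (auto simp: indicator_def)
      also have "\<dots> = ?I n + prob D"
        using iI igd by (simp add: integral_RN_indicator[OF g])
      finally show ?thesis using V(3) unfolding D_def by linarith
    qed
    show ?thesis using 1 2 3 by linarith
  qed
  have "(\<lambda>n. 3 * ?I n + 2 * (\<integral>x. ?c n x * ?\<rho> x \<partial>M) + e/4) \<longlonglongrightarrow> 3 * 0 + 2 * 0 + e/4"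
    by (intro tendsto_intros RN_L1_convergence[OF g k RN]) (use c_lim in simp)
  then have "\<forall>\<^sub>F n in sequentially. 3 * ?I n + 2 * (\<integral>x. ?c n x * ?\<rho> x \<partial>M) + e/4 < e"
    by (rule order_tendstoD(2)) (use e in simp)
  then have "\<forall>\<^sub>F n in sequentially. norm ((\<integral>x. \<bar>indicator B (g n x) - indicator B (k x)\<bar> * ?\<rho> x \<partial>M) - 0) < e"
  proof eventually_elim
    case (elim n)
    have "0 \<le> (\<integral>x. \<bar>indicator B (g n x) - indicator B (k x)\<bar> * ?\<rho> x \<partial>M)"
      by (auto simp: RN_nonneg intro!: integral_nonneg_AE)
    with bound[of n] elim show ?case by simp
  qed
  then show "\<exists>N. \<forall>n\<ge>N. norm ((\<integral>x. \<bar>indicator B (g n x) - indicator B (k x)\<bar> * ?\<rho> x \<partial>M) - 0) < e"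
    by (simp add: eventually_sequentially)
qed

text \<open>The weight \<open>RN M k\<close> is positive almost everywhere, so any integrable function is dominated by
  a multiple of it, apart from a part with small integral.\<close>

lemma indicator_L1_convergence:
  assumes g: "\<And>n. g n \<in> transformations M" and k: "k \<in> transformations M"
    and RN: "AE x in M. (\<lambda>n. RN M (g n) x) \<longlonglongrightarrow> RN M k x"
    and pt: "AE x in M. (\<lambda>n. p (g n x)) \<longlonglongrightarrow> p (k x)"
    and B: "B \<in> sets M" and Y: "integrable M Y"
  shows "(\<lambda>n. \<integral>x. \<bar>indicator B (g n x) - indicator B (k x)\<bar> * \<bar>Y x\<bar> \<partial>M) \<longlonglongrightarrow> (0::real)"
proof (rule LIMSEQ_I)
  fix e :: real assume e: "0 < e"
  note [measurable] = transformationsD(2)[OF g] transformationsD(2)[OF k] B borel_measurable_integrable[OF Y]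
  let ?\<rho> = "RN M k"
  note [simp] = integrable_RN[OF k]
  let ?W = "\<lambda>n x. \<bar>indicator B (g n x) - indicator B (k x)\<bar> :: real"
  let ?t = "\<lambda>K x. max 0 (\<bar>Y x\<bar> - real K * ?\<rho> x)"
  have "(\<lambda>K. \<integral>x. ?t K x \<partial>M) \<longlonglongrightarrow> (\<integral>x. 0 \<partial>M)"
  proof (rule integral_dominated_convergence[where w="\<lambda>x. \<bar>Y x\<bar>"])
    show "AE x in M. (\<lambda>K. ?t K x) \<longlonglongrightarrow> 0"
      using AE_RN_pos[OF k]
    proof eventually_elim
      case (elim x)
      obtain K0 :: nat where K0: "\<bar>Y x\<bar> / ?\<rho> x \<le> real K0" using real_arch_simple by blast
      have "?t K x = 0" if "K \<ge> K0" for K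
      proof -
        have "\<bar>Y x\<bar> \<le> real K0 * ?\<rho> x" using K0 elim by (simp add: field_simps)
        also have "\<dots> \<le> real K * ?\<rho> x" using that elim by (intro mult_right_mono) auto
        finally show ?thesis by simp
      qed
      then have "\<forall>\<^sub>F K in sequentially. ?t K x = 0" unfolding eventually_sequentially by blast
      then show ?case by (rule tendsto_eventually)
    qed
    show "AE x in M. norm (?t K x) \<le> \<bar>Y x\<bar>" for K
      by (rule AE_I2) (auto simp: RN_nonneg max_def)
  qed (use Y in auto)
  then have "\<forall>\<^sub>F K in sequentially. (\<integral>x. ?t K x \<partial>M) < e/2"
    by (rule order_tendstoD(2)) (use e in simp)
  then obtain K where K: "(\<integral>x. ?t K x \<partial>M) < e/2"
    using eventually_happens'[OF sequentially_bot] by blast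
  have it: "integrable M (?t K)" using Y by auto
  have iW: "integrable M (\<lambda>x. ?W n x * G x)" if G: "integrable M G" for G n
    by (rule Bochner_Integration.integrable_bound[OF G])
       (use borel_measurable_integrable[OF G] in \<open>auto simp: abs_mult indicator_def\<close>)
  have bound: "(\<integral>x. ?W n x * \<bar>Y x\<bar> \<partial>M) \<le> real K * (\<integral>x. ?W n x * ?\<rho> x \<partial>M) + (\<integral>x. ?t K x \<partial>M)" for n
  proof -
    have "(\<integral>x. ?W n x * \<bar>Y x\<bar> \<partial>M) \<le> (\<integral>x. real K * (?W n x * ?\<rho> x) + ?t K x \<partial>M)"
      using Y it
      by (intro integral_mono Bochner_Integration.integrable_add Bochner_Integration.integrable_mult_right iW)
         (auto simp: indicator_def RN_nonneg)
    then show ?thesis using iW[of ?\<rho> n] it by simp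
  qed
  have "(\<lambda>n. real K * (\<integral>x. ?W n x * ?\<rho> x \<partial>M) + (\<integral>x. ?t K x \<partial>M)) \<longlonglongrightarrow> real K * 0 + (\<integral>x. ?t K x \<partial>M)"
    by (intro tendsto_intros weighted_indicator_convergence[OF g k RN pt B])
  then have "\<forall>\<^sub>F n in sequentially. real K * (\<integral>x. ?W n x * ?\<rho> x \<partial>M) + (\<integral>x. ?t K x \<partial>M) < e"
    by (rule order_tendstoD(2)) (use e K in simp)
  then have "\<forall>\<^sub>F n in sequentially. norm ((\<integral>x. ?W n x * \<bar>Y x\<bar> \<partial>M) - 0) < e"
  proof eventually_elim
    case (elim n)
    have "0 \<le> (\<integral>x. ?W n x * \<bar>Y x\<bar> \<partial>M)" by (auto intro!: integral_nonneg_AE)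
    with bound[of n] elim show ?case by simp
  qed
  then show "\<exists>N. \<forall>n\<ge>N. norm ((\<integral>x. ?W n x * \<bar>Y x\<bar> \<partial>M) - 0) < e"
    by (simp add: eventually_sequentially)
qed

text \<open>The growth condition covers at once the test functions \<open>\<phi>\<close> for \<open>\<kappa>\<close> and \<open>t \<phi>(t)\<close> for \<open>t \<kappa>\<close>, with
  \<open>\<phi>\<close> bounded. Dividing by \<open>1 + t\<close> leaves a bounded function, to which dominated convergence applies,
  and Scheffe's lemma deals with the factor \<open>1 + t\<close>.\<close>

lemma RN_function_L1_convergence:
  assumes g: "\<And>n. g n \<in> transformations M" and k: "k \<in> transformations M"
    and RN: "AE x in M. (\<lambda>n. RN M (g n) x) \<longlonglongrightarrow> RN M k x"
    and [measurable]: "h \<in> borel_measurable borel" and cont: "\<And>t. 0 < t \<Longrightarrow> isCont h t"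
    and bd: "\<And>t. 0 \<le> t \<Longrightarrow> \<bar>h t\<bar> \<le> C * (1 + t)"
  shows "integrable M (\<lambda>x. h (RN M k x))" "integrable M (\<lambda>x. h (RN M (g n) x))"
    "(\<lambda>n. \<integral>x. \<bar>h (RN M (g n) x) - h (RN M k x)\<bar> \<partial>M) \<longlonglongrightarrow> (0::real)"
proof -
  note [simp] = integrable_RN[OF k] integrable_RN[OF g]
  have C: "0 \<le> C" using bd[of 0] abs_ge_zero[of "h 0"] by simp
  have int: "integrable M (\<lambda>x. h (RN M u x))" if "u \<in> transformations M" for u
    by (rule Bochner_Integration.integrable_bound[where f="\<lambda>x. C * (1 + RN M u x)"])
       (use integrable_RN[OF that] bd C in \<open>auto simp: RN_nonneg intro!: AE_I2\<close>)
  show ih: "integrable M (\<lambda>x. h (RN M k x))" "integrable M (\<lambda>x. h (RN M (g n) x))" for n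
    by (rule int, fact)+
  let ?\<rho> = "RN M k"
  define j where "j t = h t / (1 + \<bar>t\<bar>)" for t
  have [measurable]: "j \<in> borel_measurable borel" unfolding j_def[abs_def] by measurable
  have j_bd: "\<bar>j t\<bar> \<le> C" if "0 \<le> t" for t
    using bd[OF that] that by (simp add: j_def abs_divide field_simps)
  have h_j: "h t = (1 + t) * j t" if "0 \<le> t" for t using that by (simp add: j_def)
  have j_cont: "isCont j t" if "0 < t" for t
    unfolding j_def[abs_def] using cont[OF that] by (auto intro!: continuous_intros)
  let ?d = "\<lambda>n x. \<bar>j (RN M (g n) x) - j (?\<rho> x)\<bar> * (1 + ?\<rho> x)"
  have id: "integrable M (?d n)" and dbd: "norm (?d n x) \<le> 2 * C * (1 + ?\<rho> x)" for n x
  proof -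
    show *: "norm (?d n x) \<le> 2 * C * (1 + ?\<rho> x)" for x
    proof -
      have "\<bar>j (RN M (g n) x) - j (?\<rho> x)\<bar> \<le> 2 * C"
        using j_bd[OF RN_nonneg[of "g n" x]] j_bd[OF RN_nonneg[of k x]] by linarith
      then show ?thesis using RN_nonneg[of k x] by (auto simp: abs_mult intro: mult_right_mono)
    qed
    show "integrable M (?d n)"
    proof (rule Bochner_Integration.integrable_bound[where f="\<lambda>x. 2 * C * (1 + ?\<rho> x)"])
      show "AE x in M. norm (?d n x) \<le> norm (2 * C * (1 + ?\<rho> x))"
        by (intro AE_I2 order_trans[OF *]) (simp only: real_norm_def abs_ge_self)
    qed auto
  qed
  have d0: "(\<lambda>n. \<integral>x. ?d n x \<partial>M) \<longlonglongrightarrow> (\<integral>x. 0 \<partial>M)"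
  proof (rule integral_dominated_convergence[where w="\<lambda>x. 2 * C * (1 + ?\<rho> x)"])
    show "AE x in M. (\<lambda>n. ?d n x) \<longlonglongrightarrow> 0"
      using RN AE_RN_pos[OF k]
    proof eventually_elim
      case (elim x)
      have "(\<lambda>n. j (RN M (g n) x)) \<longlonglongrightarrow> j (?\<rho> x)"
        by (rule isCont_tendsto_compose[OF j_cont[OF elim(2)] elim(1)])
      then have "(\<lambda>n. \<bar>j (RN M (g n) x) - j (?\<rho> x)\<bar> * (1 + ?\<rho> x)) \<longlonglongrightarrow> \<bar>j (?\<rho> x) - j (?\<rho> x)\<bar> * (1 + ?\<rho> x)"
        by (intro tendsto_intros)
      then show ?case by simp
    qed
  qed (use dbd in auto)
  have bound: "(\<integral>x. \<bar>h (RN M (g n) x) - h (?\<rho> x)\<bar> \<partial>M)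
      \<le> C * (\<integral>x. \<bar>RN M (g n) x - ?\<rho> x\<bar> \<partial>M) + (\<integral>x. ?d n x \<partial>M)" for n
  proof -
    have "(\<integral>x. \<bar>h (RN M (g n) x) - h (?\<rho> x)\<bar> \<partial>M) \<le> (\<integral>x. C * \<bar>RN M (g n) x - ?\<rho> x\<bar> + ?d n x \<partial>M)"
    proof (intro integral_mono)
      fix x
      let ?s = "RN M (g n) x" and ?t = "?\<rho> x"
      have s: "0 \<le> ?s" and t: "0 \<le> ?t" by (rule RN_nonneg)+
      have "h ?s - h ?t = (?s - ?t) * j ?s + (j ?s - j ?t) * (1 + ?t)"
        using h_j[OF s] h_j[OF t] by (simp add: algebra_simps)
      also have "\<bar>\<dots>\<bar> \<le> \<bar>?s - ?t\<bar> * \<bar>j ?s\<bar> + \<bar>j ?s - j ?t\<bar> * (1 + ?t)"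
        using t abs_triangle_ineq[of "(?s - ?t) * j ?s" "(j ?s - j ?t) * (1 + ?t)"] by (simp add: abs_mult)
      also have "\<dots> \<le> \<bar>?s - ?t\<bar> * C + \<bar>j ?s - j ?t\<bar> * (1 + ?t)"
        using j_bd[OF s] by (intro add_right_mono mult_left_mono) auto
      finally show "\<bar>h ?s - h ?t\<bar> \<le> C * \<bar>?s - ?t\<bar> + ?d n x" by (simp add: mult.commute)
    qed (use ih id in auto)
    also have "\<dots> = C * (\<integral>x. \<bar>RN M (g n) x - ?\<rho> x\<bar> \<partial>M) + (\<integral>x. ?d n x \<partial>M)"
      using id by (subst Bochner_Integration.integral_add) auto
    finally show ?thesis .
  qed
  have "(\<lambda>n. C * (\<integral>x. \<bar>RN M (g n) x - ?\<rho> x\<bar> \<partial>M) + (\<integral>x. ?d n x \<partial>M)) \<longlonglongrightarrow> C * 0 + 0"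
    by (intro tendsto_intros RN_L1_convergence[OF g k RN]) (use d0 in simp)
  then have lim: "(\<lambda>n. C * (\<integral>x. \<bar>RN M (g n) x - ?\<rho> x\<bar> \<partial>M) + (\<integral>x. ?d n x \<partial>M)) \<longlonglongrightarrow> 0" by simp
  show "(\<lambda>n. \<integral>x. \<bar>h (RN M (g n) x) - h (RN M k x)\<bar> \<partial>M) \<longlonglongrightarrow> 0"
    by (rule tendsto_sandwich[OF _ _ tendsto_const lim])
       (use bound in \<open>auto intro!: always_eventually integral_nonneg_AE\<close>)
qed

lemma kappa_integral_convergence:
  assumes g: "\<And>n. g n \<in> transformations M" and k: "k \<in> transformations M"
    and RN: "AE x in M. (\<lambda>n. RN M (g n) x) \<longlonglongrightarrow> RN M k x"
    and pt: "AE x in M. (\<lambda>n. p (g n x)) \<longlonglongrightarrow> p (k x)"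
    and A: "A \<in> sets M" and B: "B \<in> sets M"
    and h [measurable]: "h \<in> borel_measurable borel" and cont: "\<And>t. 0 < t \<Longrightarrow> isCont h t"
    and bd: "\<And>t. 0 \<le> t \<Longrightarrow> \<bar>h t\<bar> \<le> C * (1 + t)"
  shows "(\<lambda>n. \<integral>t. h t \<partial>kappa_rep M (g n) A B) \<longlonglongrightarrow> (\<integral>t. h t \<partial>kappa_rep M k A B)"
proof -
  note [measurable] = transformationsD(2)[OF g] transformationsD(2)[OF k] A B
  note L1 = RN_function_L1_convergence[OF g k RN h cont bd, simplified]
  let ?W = "\<lambda>n x. \<bar>indicator B (g n x) - indicator B (k x)\<bar> :: real"
  let ?e = "\<lambda>n. (\<integral>x. \<bar>h (RN M (g n) x) - h (RN M k x)\<bar> \<partial>M) + (\<integral>x. ?W n x * \<bar>h (RN M k x)\<bar> \<partial>M)"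
  have e: "?e \<longlonglongrightarrow> 0"
    using tendsto_add[OF L1(3) indicator_L1_convergence[OF g k RN pt B L1(1)]] by simp
  have iF: "integrable M (\<lambda>x. F x * G x)"
    if "integrable M G" "\<And>x. \<bar>F x\<bar> \<le> 1" and [measurable]: "F \<in> borel_measurable M" for F G :: "'a \<Rightarrow> real"
    by (rule Bochner_Integration.integrable_bound[OF that(1)])
       (use that(2) borel_measurable_integrable[OF that(1)] in \<open>auto simp: abs_mult intro!: mult_left_le_one_le\<close>)
  have "norm ((\<integral>t. h t \<partial>kappa_rep M (g n) A B) - (\<integral>t. h t \<partial>kappa_rep M k A B)) \<le> ?e n" for n
  proof -
    let ?F = "\<lambda>u x. indicator A x * indicator B (u x) * h (RN M u x)"
    have i: "integrable M (?F (g n))" "integrable M (?F k)"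
      by (rule iF[OF L1(2)] iF[OF L1(1)]; auto simp: indicator_def)+
    have "norm ((\<integral>t. h t \<partial>kappa_rep M (g n) A B) - (\<integral>t. h t \<partial>kappa_rep M k A B))
        = norm (\<integral>x. ?F (g n) x - ?F k x \<partial>M)"
      using i by (simp add: integral_kappa_rep[OF g A B h] integral_kappa_rep[OF k A B h])
    also have "\<dots> \<le> (\<integral>x. norm (?F (g n) x - ?F k x) \<partial>M)" by (rule integral_norm_bound)
    also have "\<dots> \<le> (\<integral>x. \<bar>h (RN M (g n) x) - h (RN M k x)\<bar> + ?W n x * \<bar>h (RN M k x)\<bar> \<partial>M)"
      using i L1(1,2)
      by (intro integral_mono Bochner_Integration.integrable_add iF integrable_norm Bochner_Integration.integrable_diff)
         (auto simp: indicator_def)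
    also have "\<dots> = ?e n"
      using L1(1,2) by (subst Bochner_Integration.integral_add) (auto intro!: iF simp: indicator_def)
    finally show ?thesis .
  qed
  then have "(\<lambda>n. norm ((\<integral>t. h t \<partial>kappa_rep M (g n) A B) - (\<integral>t. h t \<partial>kappa_rep M k A B))) \<longlonglongrightarrow> 0"
    by (intro tendsto_sandwich[OF _ _ tendsto_const e]) auto
  then show ?thesis by (simp only: tendsto_norm_zero_iff LIM_zero_iff)
qed

text \<open>The sets \<open>A\<close> and \<open>B\<close> enter the measures \<open>\<kappa>\<close> through indicators and the test function through a
  function of the derivative, and both factors converge in \<open>L\<^sup>1\<close> by the lemmas above.\<close>

lemma limitin_Gms_topology:
  assumes g: "\<And>n. g n \<in> transformations M" and k: "k \<in> transformations M"
    and RN: "AE x in M. (\<lambda>n. RN M (g n) x) \<longlonglongrightarrow> RN M k x"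
    and pt: "AE x in M. (\<lambda>n. p (g n x)) \<longlonglongrightarrow> p (k x)"
  shows "limitin (Gms_topology M) (\<lambda>n. cls M (g n)) (cls M k) sequentially"
  unfolding Gms_topology_def
proof (rule limitin_initial_topology)
  show "cls M k \<in> carrier (Gms M)" "cls M (g n) \<in> carrier (Gms M)" for n
    by (rule cls_in, fact)+
  have kap: "kappa M (cls M u) A B = kappa_rep M u A B"
    if "u \<in> transformations M" "A \<in> sets M" "B \<in> sets M" for u A B
    using that by (intro kappa_class cls_in) auto
  have lim: "limitin weak_topology (\<lambda>n. kappa M (cls M (g n)) A B) (kappa M (cls M k) A B) sequentially"
    "limitin weak_topology (\<lambda>n. tmult (kappa M (cls M (g n)) A B)) (tmult (kappa M (cls M k) A B)) sequentially"
    if A: "A \<in> sets M" and B: "B \<in> sets M" for A B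
  proof -
    have *: "(\<lambda>n. \<integral>t. \<phi> t \<partial>kappa_rep M (g n) A B) \<longlonglongrightarrow> (\<integral>t. \<phi> t \<partial>kappa_rep M k A B)"
      "(\<lambda>n. \<integral>t. \<phi> t \<partial>tmult (kappa_rep M (g n) A B)) \<longlonglongrightarrow> (\<integral>t. \<phi> t \<partial>tmult (kappa_rep M k A B))"
      if cont: "continuous_on {0<..} \<phi>" and bdd: "bounded (\<phi> ` {0<..})" for \<phi> :: "real \<Rightarrow> real"
    proof -
      obtain C where C: "\<And>t. 0 < t \<Longrightarrow> \<bar>\<phi> t\<bar> \<le> C" using bdd by (auto simp: bounded_iff)
      have C0: "0 \<le> C" using C[of 1] by linarith
      let ?h = "\<lambda>t. if t \<in> {0<..} then \<phi> t else 0"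
      have h [measurable]: "?h \<in> borel_measurable borel"
        by (rule borel_measurable_continuous_on_if) (use cont in auto)
      have hc: "isCont ?h t" if "0 < t" for t
      proof -
        have "continuous_on {0<..} ?h"
          by (rule continuous_on_cong[THEN iffD1, OF refl _ cont]) simp
        then show ?thesis using that by (auto simp: continuous_on_eq_continuous_at)
      qed
      have hb: "\<bar>?h t\<bar> \<le> C" for t using C C0 by auto
      have 1: "(\<integral>t. \<phi> t \<partial>kappa_rep M u A B) = (\<integral>t. ?h t \<partial>kappa_rep M u A B)" for u
        by (rule Bochner_Integration.integral_cong) auto
      have 2: "(\<integral>t. \<phi> t \<partial>tmult (kappa_rep M u A B)) = (\<integral>t. t * ?h t \<partial>kappa_rep M u A B)"
        if "u \<in> transformations M" for u
      proof -
        have "(\<integral>t. \<phi> t \<partial>tmult (kappa_rep M u A B)) = (\<integral>t. ?h t \<partial>tmult (kappa_rep M u A B))"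
          by (rule Bochner_Integration.integral_cong) (auto simp: tmult_def)
        then show ?thesis by (simp only: integral_tmult_kappa_rep[OF that A B h])
      qed
      show "(\<lambda>n. \<integral>t. \<phi> t \<partial>kappa_rep M (g n) A B) \<longlonglongrightarrow> (\<integral>t. \<phi> t \<partial>kappa_rep M k A B)"
        unfolding 1
      proof (rule kappa_integral_convergence[OF g k RN pt A B h hc])
        fix t :: real assume "0 \<le> t"
        then have "C \<le> C * (1 + t)" using C0 by (simp add: mult_le_cancel_left1)
        then show "\<bar>?h t\<bar> \<le> C * (1 + t)" using hb[of t] by linarith
      qed
      show "(\<lambda>n. \<integral>t. \<phi> t \<partial>tmult (kappa_rep M (g n) A B)) \<longlonglongrightarrow> (\<integral>t. \<phi> t \<partial>tmult (kappa_rep M k A B))"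
        unfolding 2[OF g] 2[OF k]
      proof (rule kappa_integral_convergence[OF g k RN pt A B])
        show "(\<lambda>t. t * ?h t) \<in> borel_measurable borel" by (intro borel_measurable_times h) simp
        show "isCont (\<lambda>t. t * ?h t) t" if "0 < t" for t
          using hc[OF that] by (intro continuous_mult) auto
        fix t :: real assume t: "0 \<le> t"
        have "\<bar>t * ?h t\<bar> \<le> t * C" unfolding abs_mult using t hb[of t] by (intro mult_mono) auto
        also have "\<dots> \<le> C * (1 + t)" using C0 by (simp add: algebra_simps)
        finally show "\<bar>t * ?h t\<bar> \<le> C * (1 + t)" .
      qed
    qed
    show "limitin weak_topology (\<lambda>n. kappa M (cls M (g n)) A B) (kappa M (cls M k) A B) sequentially"
      "limitin weak_topology (\<lambda>n. tmult (kappa M (cls M (g n)) A B)) (tmult (kappa M (cls M k) A B)) sequentially"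
      unfolding kap[OF g A B] kap[OF k A B]
      by (rule limitin_weak_topology; intro kappa_rep_finite g k A B *; assumption)+
  qed
  fix H assume "H \<in> {\<lambda>G. kappa M G A B | A B. A \<in> sets M \<and> B \<in> sets M} \<union>
      {\<lambda>G. tmult (kappa M G A B) | A B. A \<in> sets M \<and> B \<in> sets M}"
  then show "limitin weak_topology (\<lambda>n. H (cls M (g n))) (H (cls M k)) sequentially"
    using lim by auto
qed

end

section \<open>Monotone transformations and sorting\<close>

context unit_coordinate
begin

definition pos_density :: "('a \<Rightarrow> real) \<Rightarrow> bool" where
  "pos_density w \<longleftrightarrow> w \<in> borel_measurable M \<and> (AE x in M. 0 < w x) \<and> (\<integral>\<^sup>+x. w x \<partial>M) = 1"

text \<open>In the coordinate, the increasing map \<open>x \<mapsto> \<integral>\<^sub>0\<^sup>x w\<close> of the unit interval.\<close>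

definition monotone_transformation :: "('a \<Rightarrow> real) \<Rightarrow> 'a \<Rightarrow> 'a" where
  "monotone_transformation w = (SOME g. g \<in> transformations M \<and> (AE x in M. RN M g x = w x) \<and>
     (AE x in M. p (g x) = cdf (distr (density M w) borel p) (p x)))"

lemma monotone_transformation:
  assumes "pos_density w"
  shows "monotone_transformation w \<in> transformations M"
    "AE x in M. RN M (monotone_transformation w) x = w x"
    "AE x in M. p (monotone_transformation w x) = cdf (distr (density M w) borel p) (p x)"
proof -
  have w: "w \<in> borel_measurable M" "AE x in M. 0 < w x" "(\<integral>\<^sup>+x. w x \<partial>M) = 1"
    using assms unfolding pos_density_def by blast+
  have "(\<lambda>t::real. t) \<in> borel_measurable borel" "AE x in M. p x = p x" by simp_all
  from ranking_transformation[OF w p_borel this]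
  have "\<exists>g. g \<in> transformations M \<and> (AE x in M. RN M g x = w x) \<and>
     (AE x in M. p (g x) = cdf (distr (density M w) borel p) (p x))" by blast
  from someI_ex[OF this, folded monotone_transformation_def]
  show "monotone_transformation w \<in> transformations M"
    "AE x in M. RN M (monotone_transformation w) x = w x"
    "AE x in M. p (monotone_transformation w x) = cdf (distr (density M w) borel p) (p x)" by blast+
qed

lemma cdf_weighted:
  assumes w: "pos_density w"
  shows "integrable M w" "cdf (distr (density M w) borel p) a = (\<integral>x. w x * indicator {..a} (p x) \<partial>M)"
proof -
  have [measurable]: "w \<in> borel_measurable M" and w0: "AE x in M. 0 \<le> w x"
    using w by (auto simp: pos_density_def elim: AE_mp)
  show "integrable M w"
    using w w0 by (intro integrableI_nonneg) (auto simp: pos_density_def)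
  have "cdf (distr (density M w) borel p) a = (\<integral>t. indicator {..a} t \<partial>distr (density M w) borel p)"
    by (simp add: cdf_def)
  also have "\<dots> = (\<integral>x. indicator {..a} (p x) \<partial>density M w)"
    by (rule integral_distr) auto
  also have "\<dots> = (\<integral>x. w x * indicator {..a} (p x) \<partial>M)"
    using w0 by (subst integral_density) auto
  finally show "cdf (distr (density M w) borel p) a = (\<integral>x. w x * indicator {..a} (p x) \<partial>M)" .
qed

text \<open>By Scheffe's lemma the densities converge in \<open>L\<^sup>1\<close>, hence their primitives converge at every
  point; so both conditions of the convergence criterion hold.\<close>

lemma limitin_monotone_transformation:
  assumes w: "\<And>n. pos_density (w n)" and v: "pos_density v"
    and lim: "AE x in M. (\<lambda>n. w n x) \<longlonglongrightarrow> v x"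
  shows "limitin (Gms_topology M) (\<lambda>n. cls M (monotone_transformation (w n)))
    (cls M (monotone_transformation v)) sequentially"
proof (rule limitin_Gms_topology)
  note W = monotone_transformation[OF w] and V = monotone_transformation[OF v]
  show "monotone_transformation (w n) \<in> transformations M" for n by (rule W)
  show "monotone_transformation v \<in> transformations M" by (rule V)
  have RNn: "AE x in M. \<forall>n. RN M (monotone_transformation (w n)) x = w n x"
    using W(2) by (simp add: AE_all_countable)
  show RN: "AE x in M. (\<lambda>n. RN M (monotone_transformation (w n)) x) \<longlonglongrightarrow> RN M (monotone_transformation v) x"
    using RNn V(2) lim by eventually_elim simp
  have [measurable]: "w n \<in> borel_measurable M" "v \<in> borel_measurable M" for n
    using w v by (auto simp: pos_density_def)
  have "(\<integral>x. \<bar>RN M (monotone_transformation (w n)) x - RN M (monotone_transformation v) x\<bar> \<partial>M)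
      = (\<integral>x. \<bar>w n x - v x\<bar> \<partial>M)" for n
    using W(2)[of n] V(2) by (intro integral_cong_AE) (auto elim!: AE_mp)
  then have L1: "(\<lambda>n. \<integral>x. \<bar>w n x - v x\<bar> \<partial>M) \<longlonglongrightarrow> 0"
    using RN_L1_convergence[OF W(1) V(1) RN] by simp
  have F: "(\<lambda>n. cdf (distr (density M (w n)) borel p) a) \<longlonglongrightarrow> cdf (distr (density M v) borel p) a" for a
  proof -
    have "\<bar>cdf (distr (density M (w n)) borel p) a - cdf (distr (density M v) borel p) a\<bar>
        \<le> (\<integral>x. \<bar>w n x - v x\<bar> \<partial>M)" for n
    proof -
      have i: "integrable M (\<lambda>x. u x * indicator {..a} (p x))" if "integrable M u" for u :: "'a \<Rightarrow> real"
        by (rule Bochner_Integration.integrable_bound[OF that])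
           (use borel_measurable_integrable[OF that] in \<open>auto simp: indicator_def\<close>)
      note iw = cdf_weighted(1)[OF w, of n] and iv = cdf_weighted(1)[OF v]
      have "\<bar>cdf (distr (density M (w n)) borel p) a - cdf (distr (density M v) borel p) a\<bar>
          = norm (\<integral>x. w n x * indicator {..a} (p x) - v x * indicator {..a} (p x) \<partial>M)"
        using i[OF iw] i[OF iv] by (simp add: cdf_weighted(2)[OF w] cdf_weighted(2)[OF v])
      also have "\<dots> \<le> (\<integral>x. norm (w n x * indicator {..a} (p x) - v x * indicator {..a} (p x)) \<partial>M)"
        by (rule integral_norm_bound)
      also have "\<dots> \<le> (\<integral>x. \<bar>w n x - v x\<bar> \<partial>M)"
        using i[OF iw] i[OF iv] iw iv by (intro integral_mono) (auto simp: indicator_def)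
      finally show ?thesis .
    qed
    then have "(\<lambda>n. \<bar>cdf (distr (density M (w n)) borel p) a - cdf (distr (density M v) borel p) a\<bar>) \<longlonglongrightarrow> 0"
      by (intro tendsto_sandwich[OF _ _ tendsto_const L1]) auto
    then show ?thesis by (simp only: tendsto_rabs_zero_iff LIM_zero_iff)
  qed
  have "AE x in M. \<forall>n. p (monotone_transformation (w n) x) = cdf (distr (density M (w n)) borel p) (p x)"
    using W(3) by (simp add: AE_all_countable)
  then show "AE x in M. (\<lambda>n. p (monotone_transformation (w n) x)) \<longlonglongrightarrow> p (monotone_transformation v x)"
    using V(3) by eventually_elim (use F in simp)
qed

lemma pos_density_quantile:
  assumes "real_distribution \<Lambda>" and pos: "AE t in \<Lambda>. 0 < t" and int: "(\<integral>\<^sup>+t. ennreal t \<partial>\<Lambda>) = 1"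
  shows "pos_density (\<lambda>x. quantile \<Lambda> (p x))"
proof -
  interpret L: real_distribution \<Lambda> by fact
  have "(\<integral>\<^sup>+x. quantile \<Lambda> (p x) \<partial>M) = (\<integral>\<^sup>+y. quantile \<Lambda> y \<partial>distr M borel p)"
    by (rule nn_integral_distr[symmetric]) measurable
  also have "\<dots> = (\<integral>\<^sup>+y. quantile \<Lambda> y \<partial>unit_uniform)" by (simp only: distr_p)
  also have "\<dots> = (\<integral>\<^sup>+t. ennreal t \<partial>distr unit_uniform borel (quantile \<Lambda>))"
    by (rule nn_integral_distr[symmetric]) measurable
  also have "\<dots> = 1" by (simp only: L.distr_quantile int)
  finally have "(\<integral>\<^sup>+x. quantile \<Lambda> (p x) \<partial>M) = 1" .
  moreover have "AE x in M. 0 < quantile \<Lambda> (p x)"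
    using AE_p_unit by eventually_elim (blast intro: L.quantile_pos[OF pos])
  moreover have "(\<lambda>x. quantile \<Lambda> (p x)) \<in> borel_measurable M"
    by (rule measurable_compose[OF p_borel L.measurable_quantile])
  ultimately show ?thesis unfolding pos_density_def by blast
qed

text \<open>Sorting. The key records the value of \<open>\<psi>\<close> up to an error \<open>1/N\<close> and, in the digits below,
  the coordinate of the point. Ranking by it is a measure-preserving transformation, and after it
  \<open>\<psi>\<close> is within \<open>1/N\<close> of a nondecreasing function of the coordinate. The law of the key is close to
  that of \<open>\<psi>\<close>, so this function is within \<open>1/N\<close> of the nondecreasing rearrangement of \<open>\<psi>\<close>.
  An exact rearrangement need not exist: \<open>\<psi>\<close> may take each value several times.\<close>

lemma approximate_sorting:
  assumes [measurable]: "\<psi> \<in> borel_measurable M" and N: "0 < N"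
  shows "\<exists>v\<in>transformations M. distr M M v = M \<and>
    (AE x in M. \<bar>\<psi> (v x) - quantile (distr M borel \<psi>) (p x)\<bar> \<le> 2 / real N)"
proof -
  \<comment> \<open>As \<open>p x\<close> lies strictly between 0 and 1, it is the fractional part of \<open>N k(x)\<close>.\<close>
  define k where "k x = (of_int \<lfloor>real N * \<psi> x\<rfloor> + p x) / real N" for x
  have "(\<lambda>x. real_of_int \<lfloor>real N * \<psi> x\<rfloor>) \<in> borel_measurable M"
    by (rule measurable_compose[OF _ borel_measurable_real_floor]) simp
  then have [measurable]: "k \<in> borel_measurable M"
    unfolding k_def[abs_def] by (intro borel_measurable_divide borel_measurable_add) simp_all
  have "(\<lambda>t. real_of_int \<lfloor>real N * t\<rfloor>) \<in> borel_measurable borel"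
    by (rule measurable_compose[OF _ borel_measurable_real_floor]) simp
  then have d: "(\<lambda>t. frac (real N * t)) \<in> borel_measurable borel"
    unfolding frac_def by (intro borel_measurable_diff) simp_all
  have dk: "AE x in M. frac (real N * k x) = p x"
    using AE_p_unit
  proof eventually_elim
    case (elim x)
    have "real N * k x = of_int \<lfloor>real N * \<psi> x\<rfloor> + p x" using N by (simp add: k_def)
    then have "frac (real N * k x) = frac (p x)" by (simp only: frac_add_of_int_left)
    then show ?case using elim by (simp add: frac_eq)
  qed
  have k_close: "AE x in M. \<bar>k x - \<psi> x\<bar> \<le> 1 / real N"
    using AE_p_unit
  proof eventually_elim
    case (elim x)
    have "\<bar>of_int \<lfloor>real N * \<psi> x\<rfloor> + p x - real N * \<psi> x\<bar> \<le> 1" using elim by linarith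
    then have "\<bar>of_int \<lfloor>real N * \<psi> x\<rfloor> + p x - real N * \<psi> x\<bar> / real N \<le> 1 / real N"
      using N by (intro divide_right_mono) auto
    moreover have "k x - \<psi> x = (of_int \<lfloor>real N * \<psi> x\<rfloor> + p x - real N * \<psi> x) / real N"
      using N by (simp add: k_def field_simps)
    ultimately show ?case by (simp add: abs_divide)
  qed
  have one: "density M (\<lambda>x. ennreal 1) = M" by (simp add: density_1)
  have "(\<lambda>_. 1::real) \<in> borel_measurable M" "AE x in M. 0 < (1::real)" "(\<integral>\<^sup>+x. ennreal 1 \<partial>M) = 1"
    by (simp_all add: emeasure_space_1)
  from ranking_transformation[OF this \<open>k \<in> borel_measurable M\<close> d dk, unfolded one]
  obtain u where u: "u \<in> transformations M" "AE x in M. RN M u x = 1"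
    "AE x in M. quantile (distr M borel k) (p (u x)) = k x" by blast
  have "density M (RN M u) = density M (\<lambda>x. ennreal 1)"
    by (rule density_cong) (use u(2) in \<open>auto elim!: AE_mp\<close>)
  then have uM: "distr M M u = M" using distr_density_RN[OF u(1)] one by simp
  let ?v = "the_inv_into (space M) u"
  have v: "?v \<in> transformations M" by (rule the_inv_into_transformations[OF u(1)])
  have "AE x in M. \<bar>\<psi> x - quantile (distr M borel k) (p (u x))\<bar> \<le> 1 / real N"
    using u(3) k_close by eventually_elim (simp add: abs_minus_commute)
  from AE_transformation[OF v this]
  have "AE x in M. \<bar>\<psi> (?v x) - quantile (distr M borel \<psi>) (p x)\<bar> \<le> 2 / real N"
    using AE_space AE_p_unit
  proof eventually_elim
    case (elim x)
    have "u (?v x) = x"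
      by (rule f_the_inv_into_f_bij_betw[OF transformationsD(1)[OF u(1)] elim(2)])
    moreover have "\<bar>quantile (distr M borel k) (p x) - quantile (distr M borel \<psi>) (p x)\<bar> \<le> 1 / real N"
      by (rule quantile_close[OF prob_space_axioms]) (use k_close elim(3) in auto)
    ultimately show ?case using elim(1) by (simp add: field_simps)
  qed
  with v distr_the_inv_into[OF u(1) uM] show ?thesis by blast
qed

text \<open>The heart of the matter: the transformation with the rearranged derivative lies in the closure of
  the double coset of \<open>g\<close>. The monotone transformations with densities \<open>g' \<circ> v n\<close>, where the \<open>v n\<close> sort
  \<open>g'\<close> better and better, belong to that double coset and converge to it.\<close>

lemma double_coset_closure:
  assumes g: "g \<in> transformations M"
  defines "w \<equiv> \<lambda>x. quantile (distr M borel (RN M g)) (p x)"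
  shows "\<exists>H. (\<forall>n. \<exists>u\<in>Ams M. \<exists>v\<in>Ams M. H n = u \<otimes>\<^bsub>Gms M\<^esub> cls M g \<otimes>\<^bsub>Gms M\<^esub> v) \<and>
    limitin (Gms_topology M) H (cls M (monotone_transformation w)) sequentially"
proof -
  have "\<forall>n. \<exists>v. v \<in> transformations M \<and> distr M M v = M \<and>
      (AE x in M. \<bar>RN M g (v x) - w x\<bar> \<le> 2 / real (Suc n))"
    using approximate_sorting[OF measurable_RN[of g], OF zero_less_Suc] unfolding w_def by blast
  then obtain v where v: "\<And>n. v n \<in> transformations M" "\<And>n. distr M M (v n) = M"
    "\<And>n. AE x in M. \<bar>RN M g (v n x) - w x\<bar> \<le> 2 / real (Suc n)" by metis
  note [measurable] = transformationsD(2)[OF v(1)]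
  have D: "pos_density (\<lambda>x. RN M g (v n x))" for n
  proof -
    have "(\<integral>\<^sup>+x. RN M g (v n x) \<partial>M) = (\<integral>\<^sup>+x. RN M g x \<partial>distr M M (v n))"
      by (rule nn_integral_distr[symmetric]) auto
    then have "(\<integral>\<^sup>+x. RN M g (v n x) \<partial>M) = 1" by (simp only: v(2) nn_integral_RN[OF g])
    then show ?thesis
      using AE_transformation[OF v(1) AE_RN_pos[OF g]] by (simp add: pos_density_def)
  qed
  have W: "pos_density w"
    unfolding w_def
  proof (rule pos_density_quantile)
    show "real_distribution (distr M borel (RN M g))"
      by (rule real_distribution_distr[OF measurable_RN])
    show "AE t in distr M borel (RN M g). 0 < t"
      using AE_RN_pos[OF g] by (subst AE_distr_iff) auto
    show "(\<integral>\<^sup>+t. ennreal t \<partial>distr M borel (RN M g)) = 1"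
      using nn_integral_RN[OF g] by (simp add: nn_integral_distr)
  qed
  have "AE x in M. \<forall>n. \<bar>RN M g (v n x) - w x\<bar> \<le> 2 / real (Suc n)"
    using v(3) by (simp add: AE_all_countable)
  then have lim: "AE x in M. (\<lambda>n. RN M g (v n x)) \<longlonglongrightarrow> w x"
  proof eventually_elim
    case (elim x)
    have "(\<lambda>n. 2 * (1 / real (Suc n))) \<longlonglongrightarrow> 2 * 0"
      by (intro tendsto_intros LIMSEQ_Suc[OF lim_1_over_n])
    then have s: "(\<lambda>n. 2 / real (Suc n)) \<longlonglongrightarrow> 0" by simp
    have "(\<lambda>n. \<bar>RN M g (v n x) - w x\<bar>) \<longlonglongrightarrow> 0"
      by (rule tendsto_sandwich[OF _ _ tendsto_const s]) (use elim in auto)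
    then show ?case by (simp only: tendsto_rabs_zero_iff LIM_zero_iff)
  qed
  let ?H = "\<lambda>n. cls M (monotone_transformation (\<lambda>x. RN M g (v n x)))"
  have H: "\<exists>u\<in>Ams M. \<exists>v\<in>Ams M. ?H n = u \<otimes>\<^bsub>Gms M\<^esub> cls M g \<otimes>\<^bsub>Gms M\<^esub> v" for n
    by (rule double_coset_of_RN[OF monotone_transformation(1)[OF D] g v(1,2) monotone_transformation(2)[OF D]])
  show ?thesis
    by (intro exI[of _ ?H] conjI allI H limitin_monotone_transformation[OF D W lim])
qed

end

section \<open>Coordinates on a Lebesgue space\<close>

lemma sets_lebesgue_unit_uniform:
  assumes "A \<in> sets lebesgue"
  shows "A \<in> sets (completion unit_uniform)"
proof -
  obtain S N N' where A: "A = S \<union> N" "N \<subseteq> N'" "N' \<in> null_sets lborel" "S \<in> sets lborel"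
    using assms by (rule sets_completionE)
  have "N' \<in> null_sets unit_uniform"
  proof
    have "emeasure lborel ({0<..<1} \<inter> N') \<le> emeasure lborel N'"
      using A(3) by (intro emeasure_mono) auto
    then show "emeasure unit_uniform N' = 0" using A(3) by (simp add: emeasure_unit_uniform null_sets_def)
  qed (use A(3) in auto)
  then show ?thesis using A by (intro sets_completionI[of A S N N']) auto
qed

text \<open>A non-atomic measure leaves no room for the countable discrete part of a Lebesgue space, so the
  isomorphism mod 0 with an interval is defined on the whole space. It is extended by constants to the
  exceptional null sets.\<close>

lemma unit_coordinate_exists:
  assumes P: "prob_space M" and L: "lebesgue_space M" and na: "nonatomic M"
  shows "\<exists>p r. unit_coordinate M p r"
proof -
  interpret prob_space M by fact
  interpret complete_measure M using L by (simp add: lebesgue_space_def)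
  obtain D where D: "D \<subseteq> space M" "\<And>x. x \<in> D \<Longrightarrow> {x} \<in> sets M \<and> prob {x} > 0"
    and iso: "iso_mod0 (restrict_space M (space M - D)) (lebesgue_on {0..prob (space M - D)})"
    using L by (auto simp: lebesgue_space_def)
  have "D = {}"
  proof (rule ccontr)
    assume "D \<noteq> {}"
    then obtain x where "{x} \<in> sets M" "prob {x} > 0" using D(2) by blast
    then obtain B where "B \<subseteq> {x}" "0 < prob B" "prob B < prob {x}"
      using na unfolding nonatomic_def by blast
    moreover from this(1) have "B = {} \<or> B = {x}" by blast
    ultimately show False by auto
  qed
  moreover have "restrict_space M (space M) = M"
    by (rule measure_eqI) (auto simp: sets_restrict_space_iff emeasure_restrict_space intro: sets.sets_into_space[THEN subsetD])
  ultimately have iso: "iso_mod0 M (lebesgue_on {0..1::real})" using iso by (simp add: prob_space)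
  let ?L = "lebesgue_on {0..1::real}"
  obtain X Y \<phi> where X: "X \<in> sets M" "space M - X \<in> null_sets M"
    and Y: "Y \<in> sets ?L" "space ?L - Y \<in> null_sets ?L"
    and b: "bij_betw \<phi> X Y" and m: "\<phi> \<in> restrict_space M X \<rightarrow>\<^sub>M restrict_space ?L Y"
    and mi: "the_inv_into X \<phi> \<in> restrict_space ?L Y \<rightarrow>\<^sub>M restrict_space M X"
    and d: "distr (restrict_space M X) (restrict_space ?L Y) \<phi> = restrict_space ?L Y"
    using iso unfolding iso_mod0_def by blast
  have X_AE: "AE x in M. x \<in> X" using AE_not_in[OF X(2)] AE_space by eventually_elim simp
  then obtain x0 where x0: "x0 \<in> X"
    using AE_E_prob[of "\<lambda>x. x \<in> X"] emeasure_space_1 AE_False by fastforce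
  have Xs: "X \<subseteq> space M" using sets.sets_into_space[OF X(1)] .
  have Yl: "Y \<in> sets lebesgue" and Y01: "Y \<subseteq> {0..1}"
    using Y(1) by (auto simp: sets_restrict_space_iff)
  define p where "p x = (if x \<in> X then \<phi> x else 0)" for x
  define r where "r y = (if y \<in> Y then the_inv_into X \<phi> y else x0)" for y
  have id: "(\<lambda>y. y) \<in> restrict_space ?L Y \<rightarrow>\<^sub>M (borel :: real measure)"
    by (intro measurable_restrict_space1 measurable_completion) simp
  have p: "p \<in> borel_measurable M"
    unfolding p_def[abs_def]
    by (rule measurable_restrict_space_iff[THEN iffD1]) (use X Xs measurable_compose[OF m id] in \<open>auto simp: Int_absorb2\<close>)
  have restr: "restrict_space ?L Y = restrict_space lebesgue Y"
    using Yl Y01 by (subst restrict_restrict_space) (auto simp: Int_absorb1)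
  have idM: "(\<lambda>x. x) \<in> restrict_space M X \<rightarrow>\<^sub>M M"
    by (rule measurable_restrict_space1) simp
  have r_leb: "r \<in> lebesgue \<rightarrow>\<^sub>M M"
    unfolding r_def[abs_def]
    by (rule measurable_restrict_space_iff[THEN iffD1])
      (use Yl x0 Xs measurable_compose[OF mi idM] in \<open>auto simp: restr\<close>)
  have r: "r \<in> completion unit_uniform \<rightarrow>\<^sub>M M"
  proof (rule measurableI)
    show "r y \<in> space M" for y using measurable_space[OF r_leb, of y] by simp
    show "r -` A \<inter> space (completion unit_uniform) \<in> sets (completion unit_uniform)" if "A \<in> sets M" for A
      using sets_lebesgue_unit_uniform[OF measurable_sets[OF r_leb that]] by simp
  qed
  have "AE x in M. r (p x) = x"
    using X_AE
  proof eventually_elim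
    case (elim x)
    then have "\<phi> x \<in> Y" using b by (auto simp: bij_betw_def)
    then show ?case using elim b by (simp add: p_def r_def the_inv_into_f_f bij_betw_def)
  qed
  moreover have "distr M borel p = unit_uniform"
  proof (rule measure_eqI)
    fix B assume "B \<in> sets (distr M borel p)"
    then have B: "B \<in> sets borel" by simp
    have BY: "B \<inter> Y \<in> sets (restrict_space ?L Y)"
      unfolding restr using Yl B by (subst sets_restrict_space_iff) auto
    have \<phi>B: "\<phi> -` (B \<inter> Y) \<inter> X \<in> sets M"
      using measurable_sets[OF m BY] X Xs by (simp add: sets_restrict_space_iff space_restrict_space Int_absorb2)
    have "emeasure (distr M borel p) B = emeasure M (p -` B \<inter> space M)"
      by (rule emeasure_distr[OF p B])
    also have "\<dots> = emeasure M (\<phi> -` (B \<inter> Y) \<inter> X)"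
    proof (rule emeasure_eq_AE)
      show "AE x in M. x \<in> p -` B \<inter> space M \<longleftrightarrow> x \<in> \<phi> -` (B \<inter> Y) \<inter> X"
        using X_AE by eventually_elim (use b Xs in \<open>auto simp: p_def bij_betw_def\<close>)
      show "p -` B \<inter> space M \<in> sets M" by (rule measurable_sets[OF p B])
    qed (rule \<phi>B)
    also have "\<dots> = emeasure (restrict_space M X) (\<phi> -` (B \<inter> Y) \<inter> space (restrict_space M X))"
      using X Xs by (subst emeasure_restrict_space) (auto simp: space_restrict_space Int_absorb2)
    also have "\<dots> = emeasure (distr (restrict_space M X) (restrict_space ?L Y) \<phi>) (B \<inter> Y)"
      by (rule emeasure_distr[OF m BY, symmetric])
    also have "\<dots> = emeasure lebesgue (B \<inter> Y)"
      unfolding d unfolding restr using Yl by (subst emeasure_restrict_space) auto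
    also have "\<dots> = emeasure lebesgue ({0<..<1} \<inter> B)"
    proof (rule emeasure_eq_AE)
      have "{0..1} - Y \<in> null_sets lebesgue"
        using Y(2) by (auto simp: null_sets_restrict_space)
      then have "AE y in lebesgue. y \<notin> {0..1} - Y" by (rule AE_not_in)
      moreover have "AE y in lebesgue. y \<notin> {0, 1::real}"
        by (rule AE_not_in) (auto intro!: null_sets_completionI countable_imp_null_set_lborel)
      ultimately show "AE y in lebesgue. y \<in> B \<inter> Y \<longleftrightarrow> y \<in> {0<..<1} \<inter> B"
      proof eventually_elim
        case (elim y)
        then show ?case using Y01 by auto
      qed
    qed (use B Yl in auto)
    also have "\<dots> = emeasure unit_uniform B"
      using B by (simp add: emeasure_unit_uniform)
    finally show "emeasure (distr M borel p) B = emeasure unit_uniform B" .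
  qed simp
  ultimately have "unit_coordinate M p r"
    using p r by unfold_locales
  then show ?thesis by blast
qed

section \<open>A continuous section of the distribution map\<close>

text \<open>Distribution functions and their weak convergence are defined for laws on the whole line.\<close>

definition real_law :: "real measure \<Rightarrow> real measure" where
  "real_law \<nu> = distr \<nu> borel (\<lambda>t. t)"

lemma measurable_pos_borel:
  assumes "sets \<nu> = sets pos_borel" and "h \<in> borel_measurable borel"
  shows "h \<in> borel_measurable \<nu>"
proof -
  have "h \<in> borel_measurable pos_borel"
    unfolding pos_borel_def by (rule measurable_restrict_space1) fact
  then show ?thesis using assms(1) by (simp cong: measurable_cong_sets)
qed

lemma real_law_MM:
  assumes "\<nu> \<in> MM"
  shows "real_distribution (real_law \<nu>)" "AE t in real_law \<nu>. 0 < t" "(\<integral>\<^sup>+t. ennreal t \<partial>real_law \<nu>) = 1"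
proof -
  have s: "sets \<nu> = sets pos_borel" and 1: "(\<integral>\<^sup>+t. 1 \<partial>\<nu>) = 1" and t: "(\<integral>\<^sup>+t. ennreal t \<partial>\<nu>) = 1"
    using assms by (auto simp: MM_def)
  have sp: "space \<nu> = {0<..}" using sets_eq_imp_space_eq[OF s] by (simp add: pos_borel_def space_restrict_space)
  interpret prob_space \<nu> by (rule prob_spaceI) (use 1 in simp)
  have id: "(\<lambda>t. t) \<in> borel_measurable \<nu>" by (rule measurable_pos_borel[OF s]) simp
  show "real_distribution (real_law \<nu>)" unfolding real_law_def by (rule real_distribution_distr[OF id])
  show "AE t in real_law \<nu>. 0 < t"
    unfolding real_law_def by (subst AE_distr_iff[OF id]) (auto simp: sp intro!: AE_I2)
  show "(\<integral>\<^sup>+t. ennreal t \<partial>real_law \<nu>) = 1"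
    unfolding real_law_def using t by (subst nn_integral_distr[OF id]) auto
qed

lemma bounded_cts_step: "a < b \<Longrightarrow> continuous_on S (cts_step a b)" "bounded (cts_step a b ` S)"
proof -
  show "a < b \<Longrightarrow> continuous_on S (cts_step a b)"
    by (meson continuous_on_subset cts_step_uniformly_continuous subset_UNIV uniformly_continuous_imp_continuous)
  have "\<bar>cts_step a b t\<bar> \<le> 1" for t by (auto simp: cts_step_def abs_if divide_simps)
  then show "bounded (cts_step a b ` S)" by (auto simp: bounded_iff)
qed

lemma continuous_map_MM_integral:
  fixes \<phi> :: "real \<Rightarrow> real"
  assumes "continuous_on {0<..} \<phi>" "bounded (\<phi> ` {0<..})"
  shows "continuous_map MM_topology euclidean (\<lambda>\<nu>. \<integral>t. \<phi> t \<partial>\<nu>)"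
proof -
  have "continuous_map MM_topology weak_topology (\<lambda>\<nu>. \<nu>)"
    unfolding MM_topology_def
  proof (rule continuous_map_initial_topology)
    show "(\<lambda>\<nu>. \<nu>) ` MM \<subseteq> topspace weak_topology"
      by (auto simp: MM_def weak_topology_def finite_pos_measures_def intro!: finite_measureI)
  qed simp
  moreover have "continuous_map weak_topology euclidean (\<lambda>\<nu>. \<integral>t. \<phi> t \<partial>\<nu>)"
    unfolding weak_topology_def by (rule continuous_map_initial_topology) (use assms in auto)
  ultimately show ?thesis using continuous_map_compose by (fastforce simp: comp_def)
qed

text \<open>An enumeration of the step functions that fall from 1 to 0 between two rational numbers, padded with
  zero functions.\<close>

definition rational_step :: "nat \<Rightarrow> real \<Rightarrow> real" where
  "rational_step i = (case from_nat i of (a :: rat, b) \<Rightarrow>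
     if a < b then cts_step (of_rat a) (of_rat b) else (\<lambda>_. 0))"

lemma rational_step: "continuous_on S (rational_step i)" "bounded (rational_step i ` S)"
  by (auto simp: rational_step_def bounded_cts_step of_rat_less image_constant_conv split: prod.split)

text \<open>Continuity at \<open>\<nu>\<close> is tested along sequences, although \<open>\<M>\<close> is topologized by an uncountable family
  of functions: a sequence that runs through the neighbourhoods \<open>V n\<close> of \<open>\<nu>\<close>, each given by finitely
  many step functions with rational ends, converges weakly. Then the quantile functions converge
  almost everywhere, and so do the derivatives of the monotone transformations. Their integrals are
  all equal to 1 by the definition of \<open>\<M>\<close>, and this prevents a loss of mass in the limit.\<close>

lemma (in unit_coordinate) continuous_map_monotone_transformation:
  "continuous_map MM_topology (Gms_topology M)
     (\<lambda>\<nu>. cls M (monotone_transformation (\<lambda>x. quantile (real_law \<nu>) (p x))))"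
  unfolding continuous_map_def
proof (intro conjI allI impI)
  let ?s = "\<lambda>\<nu>. cls M (monotone_transformation (\<lambda>x. quantile (real_law \<nu>) (p x)))"
  have top: "topspace MM_topology = MM" by (simp add: MM_topology_def)
  have dens: "pos_density (\<lambda>x. quantile (real_law \<nu>) (p x))" if "\<nu> \<in> MM" for \<nu>
    using real_law_MM[OF that] by (rule pos_density_quantile)
  show "?s \<in> topspace MM_topology \<rightarrow> topspace (Gms_topology M)"
    using monotone_transformation(1)[OF dens] by (auto simp: top Gms_topology_def intro!: cls_in)
  fix U assume U: "openin (Gms_topology M) U"
  show "openin MM_topology {\<nu> \<in> topspace MM_topology. ?s \<nu> \<in> U}"
  proof (subst openin_subopen, intro ballI)
    fix \<nu> assume "\<nu> \<in> {\<nu> \<in> topspace MM_topology. ?s \<nu> \<in> U}"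
    then have \<nu>: "\<nu> \<in> MM" "?s \<nu> \<in> U" by (auto simp: top)
    define V where "V n = (\<Inter>i\<in>{..n}. {\<mu> \<in> topspace MM_topology.
      (\<integral>t. rational_step i t \<partial>\<mu>) \<in> ball (\<integral>t. rational_step i t \<partial>\<nu>) (1 / real (Suc n))})" for n
    have V: "openin MM_topology (V n)" for n
      unfolding V_def
      by (intro openin_INT2 openin_continuous_map_preimage[OF continuous_map_MM_integral] rational_step) auto
    have \<nu>V: "\<nu> \<in> V n" for n by (auto simp: V_def top \<nu>)
    have "\<exists>n. V n \<subseteq> {\<nu> \<in> topspace MM_topology. ?s \<nu> \<in> U}"
    proof (rule ccontr)
      assume "\<not> ?thesis"
      then have "\<forall>n. \<exists>\<mu>. \<mu> \<in> V n \<and> \<mu> \<notin> {\<nu> \<in> topspace MM_topology. ?s \<nu> \<in> U}" by blast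
      from choice[OF this] obtain \<mu> where
        \<mu>: "\<And>n. \<mu> n \<in> V n" "\<And>n. \<mu> n \<notin> {\<nu> \<in> topspace MM_topology. ?s \<nu> \<in> U}" by blast
      have \<mu>M: "\<mu> n \<in> MM" for n using \<mu>(1)[of n] by (auto simp: V_def top)
      have lim: "(\<lambda>n. \<integral>t. rational_step i t \<partial>\<mu> n) \<longlonglongrightarrow> (\<integral>t. rational_step i t \<partial>\<nu>)" for i
      proof (rule metric_LIMSEQ_I)
        fix e :: real assume "0 < e"
        then obtain N where N: "1 / real (Suc N) < e" using nat_approx_posE by blast
        have "dist (\<integral>t. rational_step i t \<partial>\<mu> n) (\<integral>t. rational_step i t \<partial>\<nu>) < e" if n: "n \<ge> max i N" for n
        proof -
          have "i \<in> {..n}" using n by simp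
          then have "dist (\<integral>t. rational_step i t \<partial>\<mu> n) (\<integral>t. rational_step i t \<partial>\<nu>) < 1 / real (Suc n)"
            using \<mu>(1)[of n] unfolding V_def by (auto simp: dist_commute)
          also have "\<dots> \<le> 1 / real (Suc N)" using n by (intro divide_left_mono) auto
          finally show ?thesis using N by simp
        qed
        then show "\<exists>N. \<forall>n\<ge>N. dist (\<integral>t. rational_step i t \<partial>\<mu> n) (\<integral>t. rational_step i t \<partial>\<nu>) < e" by blast
      qed
      have steps: "(\<integral>t. cts_step (of_rat a) (of_rat b) t \<partial>real_law \<kappa>) = (\<integral>t. rational_step (to_nat (a, b)) t \<partial>\<kappa>)"
        if "\<kappa> \<in> MM" "a < b" for a b \<kappa>
      proof -
        have s: "sets \<kappa> = sets pos_borel" using that by (simp add: MM_def)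
        have "cts_step (of_rat a) (of_rat b) \<in> borel_measurable borel"
          using bounded_cts_step(1)[of "of_rat a" "of_rat b" UNIV] that
          by (intro borel_measurable_continuous_onI) (simp add: of_rat_less)
        then have "(\<integral>t. cts_step (of_rat a) (of_rat b) t \<partial>real_law \<kappa>) = (\<integral>t. cts_step (of_rat a) (of_rat b) t \<partial>\<kappa>)"
          unfolding real_law_def by (intro integral_distr measurable_pos_borel[OF s]) simp_all
        then show ?thesis using that by (simp add: rational_step_def)
      qed
      have "weak_conv_m (\<lambda>n. real_law (\<mu> n)) (real_law \<nu>)"
      proof (rule weak_conv_m_rational_steps)
        show "real_distribution (real_law (\<mu> n))" "real_distribution (real_law \<nu>)" for n
          by (rule real_law_MM, fact)+
        show "(\<lambda>n. \<integral>t. cts_step (of_rat a) (of_rat b) t \<partial>real_law (\<mu> n)) \<longlonglongrightarrow>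
            (\<integral>t. cts_step (of_rat a) (of_rat b) t \<partial>real_law \<nu>)" if "a < b" for a b
          unfolding steps[OF \<mu>M that] steps[OF \<nu>(1) that] by (rule lim)
      qed
      then have "AE y in unit_uniform. (\<lambda>n. quantile (real_law (\<mu> n)) y) \<longlonglongrightarrow> quantile (real_law \<nu>) y"
        using real_law_MM(1)[OF \<mu>M] real_law_MM(1)[OF \<nu>(1)] by (intro AE_quantile_tendsto)
      then have "AE x in M. (\<lambda>n. quantile (real_law (\<mu> n)) (p x)) \<longlonglongrightarrow> quantile (real_law \<nu>) (p x)"
        by (rule AE_comp_p)
      then have "limitin (Gms_topology M) (\<lambda>n. ?s (\<mu> n)) (?s \<nu>) sequentially"
        by (intro limitin_monotone_transformation dens \<mu>M \<nu>)
      then have "\<forall>\<^sub>F n in sequentially. ?s (\<mu> n) \<in> U" using U \<nu>(2) by (auto simp: limitin_def)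
      then show False using \<mu>(2) \<mu>M by (auto simp: top eventually_sequentially)
    qed
    then show "\<exists>T. openin MM_topology T \<and> \<nu> \<in> T \<and> T \<subseteq> {\<nu> \<in> topspace MM_topology. ?s \<nu> \<in> U}"
      using V \<nu>V by blast
  qed
qed

lemma (in prob_space) real_law_Phi:
  assumes g: "g \<in> transformations M"
  shows "real_law (Phi M (cls M g)) = distr M borel (RN M g)"
proof (rule measure_eqI)
  have Phi: "Phi M (cls M g) = kappa_rep M g (space M) (space M)"
    unfolding Phi_def using g by (intro kappa_class cls_in) auto
  fix B assume "B \<in> sets (real_law (Phi M (cls M g)))"
  then have B: "B \<in> sets borel" by (simp add: real_law_def)
  have BE: "B \<inter> {0<..} \<in> sets pos_borel" using B by (auto simp: pos_borel_def sets_restrict_space)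
  have id: "(\<lambda>t. t) \<in> borel_measurable (kappa_rep M g (space M) (space M))"
    by (rule measurable_pos_borel) simp_all
  have "emeasure (real_law (Phi M (cls M g))) B
      = emeasure (kappa_rep M g (space M) (space M)) ((\<lambda>t. t) -` B \<inter> {0<..})"
    unfolding real_law_def Phi using emeasure_distr[OF id B] by simp
  also have "(\<lambda>t. t) -` B \<inter> {0<..} = B \<inter> {0<..}" by simp
  also have "emeasure (kappa_rep M g (space M) (space M)) \<dots> = emeasure M {x \<in> space M. x \<in> space M \<and> g x \<in> space M \<and> RN M g x \<in> B \<inter> {0<..}}"
    by (rule emeasure_kappa_rep[OF g _ _ BE]) auto
  also have "\<dots> = emeasure M (RN M g -` B \<inter> space M)"
  proof (rule emeasure_eq_AE)
    note [measurable] = transformationsD(2)[OF g] B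
    show "{x \<in> space M. x \<in> space M \<and> g x \<in> space M \<and> RN M g x \<in> B \<inter> {0<..}} \<in> sets M"
      by measurable
    show "RN M g -` B \<inter> space M \<in> sets M" by measurable
    show "AE x in M. x \<in> {x \<in> space M. x \<in> space M \<and> g x \<in> space M \<and> RN M g x \<in> B \<inter> {0<..}} \<longleftrightarrow>
        x \<in> RN M g -` B \<inter> space M"
      using AE_RN_pos[OF g] AE_space
    proof eventually_elim
      case (elim x)
      then show ?case using measurable_space[OF transformationsD(2)[OF g] elim(2)] by simp
    qed
  qed
  also have "\<dots> = emeasure (distr M borel (RN M g)) B" using B by (simp add: emeasure_distr)
  finally show "emeasure (real_law (Phi M (cls M g))) B = emeasure (distr M borel (RN M g)) B" .
qed (simp add: real_law_def)

section \<open>Functions constant on double cosets\<close>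

theorem theorem1p6:
  fixes M :: "'a measure"
    and f :: "('a \<Rightarrow> 'a) set \<Rightarrow> 't::metric_space"
  assumes "prob_space M" and "lebesgue_space M" and "nonatomic M"
    and "continuous_map (Gms_topology M) euclidean f"
    and "\<And>g u v. g \<in> carrier (Gms M) \<Longrightarrow> u \<in> Ams M \<Longrightarrow> v \<in> Ams M \<Longrightarrow>
           f (u \<otimes>\<^bsub>Gms M\<^esub> g \<otimes>\<^bsub>Gms M\<^esub> v) = f g"
  shows "\<exists>q. continuous_map MM_topology euclidean q \<and>
           (\<forall>g \<in> carrier (Gms M). f g = q (Phi M g))"
proof -
  obtain p r where "unit_coordinate M p r" using unit_coordinate_exists assms(1-3) by blast
  then interpret unit_coordinate M p r .
  define s where "s \<nu> = cls M (monotone_transformation (\<lambda>x. quantile (real_law \<nu>) (p x)))" for \<nu>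
  \<comment> \<open>The map \<open>q\<close> is \<open>f \<circ> s\<close>. On a given double coset \<open>f\<close> is constant, so by continuity its value there is
    its value at the point \<open>s (\<Phi> g)\<close> of the closure.\<close>
  have "continuous_map MM_topology (Gms_topology M) s"
    unfolding s_def[abs_def] by (rule continuous_map_monotone_transformation)
  then have "continuous_map MM_topology euclidean (f \<circ> s)"
    using assms(4) by (rule continuous_map_compose)
  moreover have "f G = (f \<circ> s) (Phi M G)" if "G \<in> carrier (Gms M)" for G
  proof -
    obtain g where g: "g \<in> transformations M" "G = cls M g"
      using \<open>G \<in> carrier (Gms M)\<close> unfolding carrier_Gms by blast
    obtain H where H: "\<And>n. \<exists>u\<in>Ams M. \<exists>v\<in>Ams M. H n = u \<otimes>\<^bsub>Gms M\<^esub> G \<otimes>\<^bsub>Gms M\<^esub> v"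
      "limitin (Gms_topology M) H (s (Phi M G)) sequentially"
      using double_coset_closure[OF g(1)] unfolding s_def g(2) real_law_Phi[OF g(1)] by blast
    have "limitin euclidean (f \<circ> H) (f (s (Phi M G))) sequentially"
      using H(2) assms(4) by (rule continuous_map_limit[rotated])
    moreover have "(f \<circ> H) = (\<lambda>n. f G)"
    proof
      fix n
      obtain u v where "u \<in> Ams M" "v \<in> Ams M" "H n = u \<otimes>\<^bsub>Gms M\<^esub> G \<otimes>\<^bsub>Gms M\<^esub> v" using H(1) by blast
      then show "(f \<circ> H) n = f G" using assms(5)[OF that] by simp
    qed
    ultimately have "(\<lambda>n::nat. f G) \<longlonglongrightarrow> f (s (Phi M G))" by simp
    then show ?thesis by (simp add: LIMSEQ_const_iff)
  qed
  ultimately show ?thesis by blast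
qed

end
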